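(* Let $H$ be a generalized Jacobi matrix associated with sequences $\{\varepsilon_jp_j\}_{j\ge 0}$, $\{b_j\}_{j\ge 0}$, and assume that there exists $N\in\mathbb{N}$ with $\deg p_j\le N$ for all $j\in\mathbb{Z}_+$ and that $\sup\{b_j,|p^{(j)}_k|: j\in\mathbb{Z}_+,\ k=0,\dots,k_j-1\}<\infty$. Let $\lambda\in\mathbb{C}$. Then $\lambda\in\rho(H)$ (the resolvent set of the bounded operator generated by $H$ in $\ell^2_{[0,\infty)}$) if and only if there exist a Weyl solution $\{W_j(\lambda)\}_{j=0}^\infty$ at $\lambda$ and numbers $q\in(0,1)$, $C>0$ such that $$|P_i(\lambda)W_j(\lambda)|\le C q^{\,n_j-n_i}\quad\text{for all } i,j\in\mathbb{Z}_+ \text{ with } i\le j.$$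
   Context: $\mathbb{Z}_+=\{0,1,2,\dots\}$; $\ell^2_{[0,\infty)}$ is the Hilbert space of complex square summable sequences $(w_0,w_1,\dots)$. Data: for $j\in\mathbb{Z}_+$ let $p_j(\lambda)=\lambda^{k_j}+p^{(j)}_{k_j-1}\lambda^{k_j-1}+\dots+p^{(j)}_1\lambda+p^{(j)}_0$ be a real monic polynomial of degree $k_j\ge 1$, $\varepsilon_j\in\{1,-1\}$, $b_j>0$. Put $n_0=0$, $n_j=\sum_{i=0}^{j-1}k_i$ for $j\ge 1$. For a monic polynomial $p(\lambda)=\lambda^n+p_{n-1}\lambda^{n-1}+\dots+p_0$ the companion matrix $C_p$ is the $n\times n$ matrix with ones on the first subdiagonal, last column $(-p_0,-p_1,\dots,-p_{n-1})^\top$, and zeros elsewhere. The generalized Jacobi matrix associated with $\{\varepsilon_jp_j\}$ and $\{b_j\}$ is the infinite tridiagonal block matrix $H$ with diagonal blocks $A_j=C_{p_j}$ ($k_j\times k_j$), subdiagonal blocks $B_j$ in block position $(j+1,j)$ ($k_{j+1}\times k_j$), and superdiagonal blocks $\widetilde B_j$ in block position $(j,j+1)$ ($k_j\times k_{j+1}$); the only nonzero entry of $B_j$ is its upper right corner entry, equal to $b_j$, and the only nonzero entry of $\widetilde B_j$ is its upper right corner entry, equal to $\varepsilon_j\varepsilon_{j+1}b_j$. Under the assumptions in the claim $H$ generates a bounded operator in $\ell^2_{[0,\infty)}$. The polynomials $P_j,Q_j$ are the solutions of $$\varepsilon_{j-1}\varepsilon_jb_{j-1}u_{j-1}-p_j(\lambda)u_j+b_ju_{j+1}=0\quad(j\ge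 1)$$ with initial conditions $P_0=1$, $P_1=p_0(\lambda)/b_0$, $Q_0=0$, $Q_1=\varepsilon_0/b_0$. A Weyl solution at $\lambda$ is a solution $\{W_j(\lambda)\}_{j\ge0}$ of this recurrence that belongs to $\ell^2_{[0,\infty)}$ and has the form $W_j(\lambda)=Q_j(\lambda)+m(\lambda)P_j(\lambda)$ for some complex number $m(\lambda)$. *)

theory Defs
  imports Complex_Main "HOL-Computational_Algebra.Polynomial" "Jordan_Normal_Form.Matrix"
begin

subsection \<open>Operators in the Hilbert space of square summable sequences\<close>

definition l2 :: "(nat \<Rightarrow> complex) set" where
  "l2 = {w. summable (\<lambda>n. (cmod (w n))\<^sup>2)}"

definition l2_norm :: "(nat \<Rightarrow> complex) \<Rightarrow> real" where
  "l2_norm w = sqrt (\<Sum>n. (cmod (w n))\<^sup>2)"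

definition l2_bounded_operator :: "((nat \<Rightarrow> complex) \<Rightarrow> nat \<Rightarrow> complex) \<Rightarrow> bool" where
  "l2_bounded_operator T \<longleftrightarrow>
     (\<forall>v\<in>l2. T v \<in> l2) \<and>
     (\<forall>v\<in>l2. \<forall>w\<in>l2. T (\<lambda>n. v n + w n) = (\<lambda>n. T v n + T w n)) \<and>
     (\<forall>a. \<forall>v\<in>l2. T (\<lambda>n. a * v n) = (\<lambda>n. a * T v n)) \<and>
     (\<exists>K. \<forall>v\<in>l2. l2_norm (T v) \<le> K * l2_norm v)"

text \<open>The resolvent set of a bounded operator \<open>T\<close> on \<^const>\<open>l2\<close>: \<open>R\<close> is the
  everywhere defined bounded two-sided inverse of \<open>T - zI\<close>.\<close>

definition resolvent_set :: "((nat \<Rightarrow> complex) \<Rightarrow> nat \<Rightarrow> complex) \<Rightarrow> complex set" where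
  "resolvent_set T = {z. \<exists>R. l2_bounded_operator R \<and>
     (\<forall>w\<in>l2. R (\<lambda>n. T w n - z * w n) = w) \<and>
     (\<forall>w\<in>l2. (\<lambda>n. T (R w) n - z * R w n) = w)}"

text \<open>The operator generated by an infinite matrix.  The generalized Jacobi matrices below have
  finitely many nonzero entries in each row, so that the series are finite sums.\<close>

definition matrix_operator ::
    "(nat \<Rightarrow> nat \<Rightarrow> real) \<Rightarrow> (nat \<Rightarrow> complex) \<Rightarrow> nat \<Rightarrow> complex" where
  "matrix_operator H w = (\<lambda>r. \<Sum>c. of_real (H r c) * w c)"


subsection \<open>Generalized Jacobi matrices\<close>

text \<open>Rows and columns are numbered from 0.  For degree 1 the companion matrix is
  the \<open>1 \<times> 1\<close> matrix with entry \<open>-p\<^sub>0\<close>.\<close>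

definition companion_matrix :: "real poly \<Rightarrow> real mat" where
  "companion_matrix p = mat (degree p) (degree p)
     (\<lambda>(s, t). if t = degree p - 1 then - coeff p s else if s = t + 1 then 1 else 0)"

definition corner_matrix :: "nat \<Rightarrow> nat \<Rightarrow> real \<Rightarrow> real mat" where
  "corner_matrix nr nc a = mat nr nc (\<lambda>(s, t). if s = 0 \<and> t = nc - 1 then a else 0)"

text \<open>The block \<open>j\<close> occupies the indices \<open>n\<^sub>j, \<dots>, n\<^sub>j\<^sub>+\<^sub>1 - 1\<close>.\<close>

definition block_start :: "(nat \<Rightarrow> real poly) \<Rightarrow> nat \<Rightarrow> nat" where
  "block_start p j = (\<Sum>i<j. degree (p i))"

text \<open>The index of the block containing the row (or column) \<open>r\<close>; well defined if all
  degrees are positive.\<close>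

definition block_of :: "(nat \<Rightarrow> real poly) \<Rightarrow> nat \<Rightarrow> nat" where
  "block_of p r = (LEAST j. r < block_start p (Suc j))"

definition jacobi_block ::
    "(nat \<Rightarrow> real) \<Rightarrow> (nat \<Rightarrow> real poly) \<Rightarrow> (nat \<Rightarrow> real) \<Rightarrow> nat \<Rightarrow> nat \<Rightarrow> real mat" where
  "jacobi_block \<epsilon> p b i j =
     (if i = j then companion_matrix (p j)
      else if i = Suc j then corner_matrix (degree (p i)) (degree (p j)) (b j)
      else if j = Suc i then corner_matrix (degree (p i)) (degree (p j)) (\<epsilon> i * \<epsilon> j * b i)
      else 0\<^sub>m (degree (p i)) (degree (p j)))"

definition gen_jacobi_matrix ::
    "(nat \<Rightarrow> real) \<Rightarrow> (nat \<Rightarrow> real poly) \<Rightarrow> (nat \<Rightarrow> real) \<Rightarrow> nat \<Rightarrow> nat \<Rightarrow> real" where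
  "gen_jacobi_matrix \<epsilon> p b r c =
     jacobi_block \<epsilon> p b (block_of p r) (block_of p c)
       $$ (r - block_start p (block_of p r), c - block_start p (block_of p c))"


subsection \<open>The three-term recurrence\<close>

definition cpoly :: "real poly \<Rightarrow> complex \<Rightarrow> complex" where
  "cpoly p z = poly (map_poly of_real p) z"

definition jacobi_recurrence ::
    "(nat \<Rightarrow> real) \<Rightarrow> (nat \<Rightarrow> real poly) \<Rightarrow> (nat \<Rightarrow> real) \<Rightarrow> complex \<Rightarrow> (nat \<Rightarrow> complex) \<Rightarrow> bool" where
  "jacobi_recurrence \<epsilon> p b z u \<longleftrightarrow>
     (\<forall>j\<ge>1. of_real (\<epsilon> (j - 1) * \<epsilon> j * b (j - 1)) * u (j - 1)
              - cpoly (p j) z * u j + of_real (b j) * u (j + 1) = 0)"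

text \<open>The values at \<open>z\<close> of the polynomials \<open>P\<^sub>j\<close> and \<open>Q\<^sub>j\<close>; see the
  lemmas below.\<close>

fun jacobi_P ::
    "(nat \<Rightarrow> real) \<Rightarrow> (nat \<Rightarrow> real poly) \<Rightarrow> (nat \<Rightarrow> real) \<Rightarrow> nat \<Rightarrow> complex \<Rightarrow> complex" where
  "jacobi_P \<epsilon> p b 0 z = 1"
| "jacobi_P \<epsilon> p b (Suc 0) z = cpoly (p 0) z / of_real (b 0)"
| "jacobi_P \<epsilon> p b (Suc (Suc j)) z =
     (cpoly (p (Suc j)) z * jacobi_P \<epsilon> p b (Suc j) z
        - of_real (\<epsilon> j * \<epsilon> (Suc j) * b j) * jacobi_P \<epsilon> p b j z) / of_real (b (Suc j))"

fun jacobi_Q ::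
    "(nat \<Rightarrow> real) \<Rightarrow> (nat \<Rightarrow> real poly) \<Rightarrow> (nat \<Rightarrow> real) \<Rightarrow> nat \<Rightarrow> complex \<Rightarrow> complex" where
  "jacobi_Q \<epsilon> p b 0 z = 0"
| "jacobi_Q \<epsilon> p b (Suc 0) z = of_real (\<epsilon> 0 / b 0)"
| "jacobi_Q \<epsilon> p b (Suc (Suc j)) z =
     (cpoly (p (Suc j)) z * jacobi_Q \<epsilon> p b (Suc j) z
        - of_real (\<epsilon> j * \<epsilon> (Suc j) * b j) * jacobi_Q \<epsilon> p b j z) / of_real (b (Suc j))"

lemma jacobi_recurrence_P:
  assumes "\<And>j. b j > 0"
  shows "jacobi_recurrence \<epsilon> p b z (\<lambda>j. jacobi_P \<epsilon> p b j z)"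
  unfolding jacobi_recurrence_def
proof (intro allI impI)
  fix j :: nat assume "1 \<le> j"
  then obtain i where "j = Suc i" by (cases j) auto
  moreover have "b (Suc i) \<noteq> 0" using assms[of "Suc i"] by simp
  ultimately show "of_real (\<epsilon> (j - 1) * \<epsilon> j * b (j - 1)) * jacobi_P \<epsilon> p b (j - 1) z
      - cpoly (p j) z * jacobi_P \<epsilon> p b j z + of_real (b j) * jacobi_P \<epsilon> p b (j + 1) z = 0"
    by simp
qed

lemma jacobi_recurrence_Q:
  assumes "\<And>j. b j > 0"
  shows "jacobi_recurrence \<epsilon> p b z (\<lambda>j. jacobi_Q \<epsilon> p b j z)"
  unfolding jacobi_recurrence_def
proof (intro allI impI)
  fix j :: nat assume "1 \<le> j"
  then obtain i where "j = Suc i" by (cases j) auto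
  moreover have "b (Suc i) \<noteq> 0" using assms[of "Suc i"] by simp
  ultimately show "of_real (\<epsilon> (j - 1) * \<epsilon> j * b (j - 1)) * jacobi_Q \<epsilon> p b (j - 1) z
      - cpoly (p j) z * jacobi_Q \<epsilon> p b j z + of_real (b j) * jacobi_Q \<epsilon> p b (j + 1) z = 0"
    by simp
qed

definition weyl_solution ::
    "(nat \<Rightarrow> real) \<Rightarrow> (nat \<Rightarrow> real poly) \<Rightarrow> (nat \<Rightarrow> real) \<Rightarrow> complex \<Rightarrow> (nat \<Rightarrow> complex) \<Rightarrow> bool" where
  "weyl_solution \<epsilon> p b z W \<longleftrightarrow>
     jacobi_recurrence \<epsilon> p b z W \<and> W \<in> l2 \<and>
     (\<exists>m. \<forall>j. W j = jacobi_Q \<epsilon> p b j z + m * jacobi_P \<epsilon> p b j z)"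

end

theory Submission
  imports Defs "HOL-Analysis.L2_Norm"
begin

text \<open>In every block the equation \<open>(H - z) w = f\<close> can be solved upwards from the last
  entry by Horner's scheme.  What remains is one equation \<open>J u = g\<close> per block for the signed last
  entries \<open>u\<^sub>j\<close>, where \<open>J\<close> is a symmetric tridiagonal operator whose
  homogeneous solutions are those of the three-term recurrence.  Since degrees and coefficients are
  bounded, \<open>z\<close> is in the resolvent set iff \<open>J\<close> is boundedly invertible.  The inverse
  can only be Green's function \<open>P\<^bsub>min(i,j)\<^esub> W\<^bsub>max(i,j)\<^esub>\<close> with \<open>W\<close> the Weyl
  solution.  Exponential decay makes this kernel bounded; conversely, invertibility of \<open>J\<close>
  forces exponential decay by the Combes--Thomas argument.  No lower bound on \<open>b\<^sub>j\<close> is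
  available; injectivity of \<open>J\<close> comes from the Wronskian, which is constant although
  its factors \<open>P, W\<close> would both tend to zero.\<close>

subsection \<open>Square summability through partial norms\<close>

text \<open>Bounding all partial norms states square summability and a norm estimate at once, so
  triangle inequality, monotonicity and shifts reduce to finite sums without summability side
  conditions.\<close>

definition l2_bound :: "(nat \<Rightarrow> real) \<Rightarrow> real \<Rightarrow> bool" where
  "l2_bound v M \<longleftrightarrow> (\<forall>n. L2_set v {..<n} \<le> M)"

lemma l2_bound_l2_norm:
  assumes "w \<in> l2"
  shows "l2_bound (\<lambda>i. cmod (w i)) (l2_norm w)"
  using assms unfolding l2_bound_def l2_norm_def L2_set_def l2_def
  by (auto intro: sum_le_suminf)

lemma
  assumes "l2_bound (\<lambda>i. cmod (w i)) M"
  shows l2_bound_in_l2: "w \<in> l2" and l2_bound_l2_norm_le: "l2_norm w \<le> M"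
proof -
  have M: "0 \<le> M"
    using assms[unfolded l2_bound_def, rule_format, of 0] by simp
  have le: "(\<Sum>i<n. (cmod (w i))\<^sup>2) \<le> M\<^sup>2" for n
    using assms[unfolded l2_bound_def, rule_format, of n] unfolding L2_set_def
    by (rule sqrt_le_D)
  have s: "summable (\<lambda>i. (cmod (w i))\<^sup>2)"
    by (rule summableI_nonneg_bounded[of _ "M\<^sup>2"]) (use le in auto)
  then show "w \<in> l2" by (simp add: l2_def)
  have "(\<Sum>i. (cmod (w i))\<^sup>2) \<le> M\<^sup>2"
    by (rule suminf_le_const[OF s le])
  then show "l2_norm w \<le> M"
    unfolding l2_norm_def using M by (simp add: real_le_lsqrt)
qed

lemma l2_bound_nonneg: "l2_bound v M \<Longrightarrow> 0 \<le> M"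
  unfolding l2_bound_def by (metis L2_set_nonneg order_trans)

lemma l2_bound_mono:
  assumes "l2_bound v M" "\<And>i. 0 \<le> u i" "\<And>i. u i \<le> v i"
  shows "l2_bound u M"
  using assms unfolding l2_bound_def by (meson L2_set_mono order_trans)

lemma l2_bound_add:
  assumes "l2_bound u M" "l2_bound v M'"
  shows "l2_bound (\<lambda>i. u i + v i) (M + M')"
  using assms unfolding l2_bound_def by (blast intro: order_trans[OF L2_set_triangle_ineq add_mono])

lemma l2_bound_mult:
  assumes "l2_bound v M" "0 \<le> c"
  shows "l2_bound (\<lambda>i. c * v i) (c * M)"
  using assms unfolding l2_bound_def
  by (simp add: L2_set_right_distrib[symmetric] mult_left_mono)

lemma l2_bound_Suc:
  assumes "l2_bound v M"
  shows "l2_bound (\<lambda>i. v (Suc i)) M"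
  unfolding l2_bound_def
proof
  fix n
  have "(\<Sum>i<n. (v (Suc i))\<^sup>2) \<le> (\<Sum>i<Suc n. (v i)\<^sup>2)"
    unfolding sum.lessThan_Suc_shift by simp
  then have "L2_set (\<lambda>i. v (Suc i)) {..<n} \<le> L2_set v {..<Suc n}"
    by (simp add: L2_set_def)
  then show "L2_set (\<lambda>i. v (Suc i)) {..<n} \<le> M"
    using assms unfolding l2_bound_def by (meson order_trans)
qed

lemma L2_set_pred:
  fixes v :: "nat \<Rightarrow> real"
  shows
  "L2_set (\<lambda>i. if i = 0 then 0 else v (i - 1)) {..<n} = L2_set v {..<n - 1}"
proof (cases n)
  case (Suc m)
  have "(\<Sum>i<Suc m. (if i = 0 then 0 else v (i - 1))\<^sup>2) = (\<Sum>i<m. (v i)\<^sup>2)"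
    unfolding sum.lessThan_Suc_shift by simp
  then show ?thesis by (simp add: Suc L2_set_def)
qed simp

lemma l2_bound_pred:
  assumes "l2_bound v M"
  shows "l2_bound (\<lambda>i. if i = 0 then 0 else v (i - 1)) M"
  using assms unfolding l2_bound_def by (simp add: L2_set_pred)

lemma l2_bound_component: "l2_bound v M \<Longrightarrow> v i \<le> M"
  unfolding l2_bound_def using member_le_L2_set[of "{..<Suc i}" i v]
  by (meson finite_lessThan lessI lessThan_iff order_trans)

lemma l2_bound_unit: "l2_bound (\<lambda>i. if i = k then 1 else 0) 1"
proof -
  have "L2_set (\<lambda>i. if i = k then 1 else 0 :: real) {..<n} \<le> 1" for n
  proof -
    have "L2_set (\<lambda>i. if i = k then 1 else 0 :: real) {..<n} \<le> (\<Sum>i<n. if i = k then 1 else 0)"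
      by (rule L2_set_le_sum) simp
    also have "\<dots> \<le> 1" by simp
    finally show ?thesis .
  qed
  then show ?thesis by (simp add: l2_bound_def)
qed

lemma l2_comparison:
  assumes "w \<in> l2" "\<And>i. i \<ge> n \<Longrightarrow> cmod (u i) \<le> c * cmod (w i)"
  shows "u \<in> l2"
proof -
  have "summable (\<lambda>i. c\<^sup>2 * (cmod (w i))\<^sup>2)"
    using assms(1) by (simp add: l2_def)
  moreover have "norm ((cmod (u i))\<^sup>2) \<le> c\<^sup>2 * (cmod (w i))\<^sup>2" if "i \<ge> n" for i
    using power_mono[OF assms(2)[OF that], of 2] by (simp add: power_mult_distrib)
  ultimately have "summable (\<lambda>i. (cmod (u i))\<^sup>2)"
    by (rule summable_comparison_test')
  then show ?thesis by (simp add: l2_def)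
qed

lemma l2_tendsto_0: "w \<in> l2 \<Longrightarrow> w \<longlonglongrightarrow> 0"
proof -
  assume "w \<in> l2"
  then have "(\<lambda>n. sqrt ((cmod (w n))\<^sup>2)) \<longlonglongrightarrow> sqrt 0"
    unfolding l2_def by (intro tendsto_real_sqrt summable_LIMSEQ_zero) simp
  then show ?thesis by (simp add: tendsto_norm_zero_iff)
qed

section \<open>Convolution with one-sided geometric kernels\<close>

text \<open>The recursion says that \<open>A\<close> is \<open>q\<close> times its own shift plus
  \<open>g\<close>. Shifting does not increase a partial norm, and partial norms are finite, so the
  term with \<open>q < 1\<close> can be absorbed.\<close>

lemma l2_bound_geometric_past:
  assumes g: "l2_bound g M" and q: "0 \<le> q" "q < 1"
    and A0: "A 0 = g 0" and A: "\<And>i. A (Suc i) = q * A i + g (Suc i)"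
  shows "l2_bound A (M / (1 - q))"
  unfolding l2_bound_def
proof
  fix n
  have "A = (\<lambda>i. q * (if i = 0 then 0 else A (i - 1)) + g i)"
    using A0 A by (auto simp: fun_eq_iff) (metis Suc_pred)
  then have "L2_set A {..<n} \<le> L2_set (\<lambda>i. q * (if i = 0 then 0 else A (i - 1))) {..<n} + L2_set g {..<n}"
    using L2_set_triangle_ineq by metis
  also have "\<dots> = q * L2_set A {..<n - 1} + L2_set g {..<n}"
    by (simp add: L2_set_right_distrib[OF q(1), symmetric] L2_set_pred)
  also have "\<dots> \<le> q * L2_set A {..<n} + M"
  proof (intro add_mono mult_left_mono)
    show "L2_set A {..<n - 1} \<le> L2_set A {..<n}"
      unfolding L2_set_def by (intro real_sqrt_le_mono sum_mono2) auto
    show "L2_set g {..<n} \<le> M" using g by (simp add: l2_bound_def)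
  qed (use q in auto)
  finally show "L2_set A {..<n} \<le> M / (1 - q)"
    using q by (simp add: field_simps)
qed

text \<open>Here the shift reads one entry beyond the initial segment. That entry is at most
  \<open>M / (1 - q)\<close> by the geometric series, and this costs the second factor
  \<open>1 / (1 - q)\<close>.\<close>

lemma l2_bound_geometric_future:
  assumes g: "l2_bound g M" "\<And>i. 0 \<le> g i" and q: "0 \<le> q" "q < 1"
  shows "l2_bound (\<lambda>i. \<Sum>d. q ^ d * g (i + d)) (M / (1 - q)\<^sup>2)"
  unfolding l2_bound_def
proof
  fix n
  define B where "B i = (\<Sum>d. q ^ d * g (i + d))" for i
  have qs: "summable (\<lambda>d. q ^ d * M)"
    using q by (intro summable_mult2 summable_geometric) simp
  have term_le: "q ^ d * g i \<le> q ^ d * M" for d i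
    using q l2_bound_component[OF g(1)] by (simp add: mult_left_mono)
  have s: "summable (\<lambda>d. q ^ d * g (i + d))" for i
    by (rule summable_comparison_test'[OF qs, of 0]) (use q g(2) term_le in simp)
  have rec: "B i = q * B (Suc i) + g i" for i
  proof -
    have "B i = g i + (\<Sum>d. q ^ Suc d * g (i + Suc d))"
      unfolding B_def using suminf_split_head[OF s, of i] by simp
    also have "(\<Sum>d. q ^ Suc d * g (i + Suc d)) = q * B (Suc i)"
      unfolding B_def using suminf_mult[OF s[of "Suc i"], of q] by (simp add: mult.assoc)
    finally show ?thesis by simp
  qed
  have B0: "0 \<le> B i" for i
    unfolding B_def using q g(2) by (intro suminf_nonneg s) simp
  have B_le: "B i \<le> M / (1 - q)" for i
  proof -
    have "B i \<le> (\<Sum>d. q ^ d * M)"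
      unfolding B_def by (intro suminf_le s qs term_le)
    also have "\<dots> = M / (1 - q)"
      using q suminf_geometric[of q] summable_geometric[of q]
      by (simp add: suminf_mult2[symmetric])
    finally show ?thesis .
  qed
  have "L2_set B {..<n} \<le> L2_set (\<lambda>i. q * B (Suc i)) {..<n} + L2_set g {..<n}"
    using rec L2_set_triangle_ineq[of "\<lambda>i. q * B (Suc i)" g] by (metis (no_types, lifting) L2_set_cong)
  also have "L2_set (\<lambda>i. q * B (Suc i)) {..<n} = q * L2_set (\<lambda>i. B (Suc i)) {..<n}"
    by (rule L2_set_right_distrib[OF q(1), symmetric])
  also have "L2_set (\<lambda>i. B (Suc i)) {..<n} \<le> L2_set B {..<Suc n}"
    unfolding L2_set_def sum.lessThan_Suc_shift by simp
  also have "L2_set B {..<Suc n} \<le> B n + L2_set B {..<n}"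
    using sqrt_sum_squares_le_sum[of "B n" "L2_set B {..<n}"] B0
    by (simp add: lessThan_Suc)
  also have "B n \<le> M / (1 - q)" by (rule B_le)
  also have "L2_set g {..<n} \<le> M" using g(1) by (simp add: l2_bound_def)
  finally have "L2_set B {..<n} \<le> q * (M / (1 - q) + L2_set B {..<n}) + M"
    using q(1) by (simp add: mult_left_mono)
  then have "(1 - q) * L2_set B {..<n} \<le> q * (M / (1 - q)) + M"
    by (simp add: algebra_simps)
  also have "\<dots> = M / (1 - q)" using q by (simp add: field_simps)
  finally have "L2_set B {..<n} \<le> M / (1 - q) / (1 - q)"
    using q by (simp add: pos_le_divide_eq mult.commute mult.left_commute)
  then show "L2_set (\<lambda>i. \<Sum>d. q ^ d * g (i + d)) {..<n} \<le> M / (1 - q)\<^sup>2"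
    by (simp add: B_def[abs_def] power2_eq_square)
qed

subsection \<open>The block structure\<close>

lemma sum_lessThan_add:
  fixes f :: "nat \<Rightarrow> 'a::comm_monoid_add"
  shows "(\<Sum>r<m + k. f r) = (\<Sum>r<m. f r) + (\<Sum>s<k. f (m + s))"
  by (induction k) (simp_all add: add.assoc)

text \<open>The closed form satisfies the same backward recursion, and the recursion determines all
  entries from the last one down.\<close>

lemma horner_iff:
  fixes w \<phi> :: "nat \<Rightarrow> 'a::comm_semiring_1"
  shows "(\<forall>s<k. w s = \<phi> (Suc s) + (if Suc s < k then z * w (Suc s) else 0)) \<longleftrightarrow>
    (\<forall>s<k. w s = (\<Sum>d<k - s. z ^ d * \<phi> (Suc s + d)))"
proof -
  define h where "h s = (\<Sum>d<k - s. z ^ d * \<phi> (Suc s + d))" for s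
  have h: "h s = \<phi> (Suc s) + (if Suc s < k then z * h (Suc s) else 0)" if sk: "s < k" for s
  proof -
    obtain m where m: "k = s + Suc m" using less_imp_Suc_add[OF sk] by auto
    have "h s = \<phi> (Suc s) + (\<Sum>d<m. z * (z ^ d * \<phi> (Suc (Suc s) + d)))"
      unfolding h_def m by (simp add: sum.lessThan_Suc_shift mult.assoc del: sum.lessThan_Suc)
    also have "(\<Sum>d<m. z * (z ^ d * \<phi> (Suc (Suc s) + d))) = z * h (Suc s)"
      unfolding h_def m by (simp add: sum_distrib_left)
    finally show ?thesis using m by (cases m) (simp_all add: h_def)
  qed
  \<comment> \<open>Induction on the distance to the end, since each entry depends on its
    successor.\<close>
  have wh: "w s = h s"
    if w: "\<forall>s<k. w s = \<phi> (Suc s) + (if Suc s < k then z * w (Suc s) else 0)" and s: "s < k" for s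
    using s
  proof (induction "k - s" arbitrary: s rule: less_induct)
    case less
    have "Suc s < k \<Longrightarrow> w (Suc s) = h (Suc s)" using less.hyps[of "Suc s"] less.prems by simp
    then show ?case 
       unfolding w[rule_format, OF less.prems] h[OF less.prems] by auto
  qed
  have hw: "w s = \<phi> (Suc s) + (if Suc s < k then z * w (Suc s) else 0)"
    if w: "\<forall>s<k. w s = h s" and s: "s < k" for s
    unfolding w[rule_format, OF s] h[OF s] using w by auto
  show ?thesis unfolding h_def[symmetric]
    by (intro iffI allI impI) (rule wh hw; assumption)+
qed

text \<open>The bounds get names: \<open>N\<close> for the degrees, \<open>M\<close> for both the
  \<open>b j\<close> and the coefficients below the leading one. The spectral parameter
  \<open>z\<close> is fixed throughout.\<close>

locale gen_jacobi =
  fixes \<epsilon> :: "nat \<Rightarrow> real" and p :: "nat \<Rightarrow> real poly" and b :: "nat \<Rightarrow> real" and z :: complex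
    and N :: nat and M :: real
  assumes lead: "\<And>j. lead_coeff (p j) = 1"
    and deg_pos: "\<And>j. degree (p j) \<ge> 1"
    and sign: "\<And>j. \<epsilon> j \<in> {1, -1}"
    and b_pos: "\<And>j. b j > 0"
    and deg_le: "\<And>j. degree (p j) \<le> N"
    and b_le: "\<And>j. b j \<le> M"
    and coeff_le: "\<And>j k. k < degree (p j) \<Longrightarrow> \<bar>coeff (p j) k\<bar> \<le> M"
begin

abbreviation H :: "(nat \<Rightarrow> complex) \<Rightarrow> nat \<Rightarrow> complex" where
  "H \<equiv> matrix_operator (gen_jacobi_matrix \<epsilon> p b)"

abbreviation n :: "nat \<Rightarrow> nat" where "n \<equiv> block_start p"

lemma n_Suc: "n (Suc j) = n j + degree (p j)"
  by (simp add: block_start_def)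

lemma n_0 [simp]: "n 0 = 0"
  by (simp add: block_start_def)

lemma n_mono: "i \<le> j \<Longrightarrow> n i \<le> n j"
  unfolding block_start_def by (rule sum_mono2) auto

text \<open>Each block has between 1 and \<open>N\<close> rows. This bound and
  \<open>n_diff_le\<close> convert decay rates between block indices and row indices.\<close>

lemma n_diff_ge: "i \<le> j \<Longrightarrow> j - i \<le> n j - n i"
proof (induction j rule: dec_induct)
  case (step j)
  then show ?case using n_Suc[of j] deg_pos[of j] n_mono[of i j] by linarith
qed simp

lemma n_diff_le: "i \<le> j \<Longrightarrow> n j - n i \<le> N * (j - i)"
proof (induction j rule: dec_induct)
  case (step j)
  then show ?case using n_Suc[of j] deg_le[of j] n_mono[of i j] by (simp add: Suc_diff_le)
qed simp

lemma n_ge: "j \<le> n j"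
  using n_diff_ge[of 0 j] by simp

lemma block_of_eq:
  assumes "s < degree (p j)"
  shows "block_of p (n j + s) = j"
  unfolding block_of_def
proof (rule Least_equality)
  show "n j + s < n (Suc j)" using assms by (simp add: n_Suc)
next
  fix i assume "n j + s < n (Suc i)"
  then show "j \<le> i" using n_mono[of "Suc i" j] by (cases "j \<le> i") auto
qed

text \<open>Positive degrees give \<open>r < n (Suc r)\<close>, so the minimum in
  \<open>block_of\<close> is attained.\<close>

lemma block_cases:
  obtains j s where "r = n j + s" "s < degree (p j)"
proof -
  define j where "j = block_of p r"
  have "r < n (Suc r)" using n_ge[of "Suc r"] by simp
  then have 1: "r < n (Suc j)" unfolding j_def block_of_def by (rule LeastI)
  have 2: "n j \<le> r"
  proof (cases j)
    case (Suc i)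
    then have "\<not> r < n (Suc i)"
      unfolding j_def block_of_def by (intro not_less_Least) simp
    then show ?thesis using Suc by simp
  qed simp
  show thesis
    by (rule that[of j "r - n j"]) (use 1 2 n_Suc[of j] in auto)
qed

lemma fun_eq_blocks:
  "f = g \<longleftrightarrow> (\<forall>j. \<forall>s<degree (p j). f (n j + s) = g (n j + s))"
proof
  assume *: "\<forall>j. \<forall>s<degree (p j). f (n j + s) = g (n j + s)"
  show "f = g"
  proof
    fix r
    obtain j s where "r = n j + s" "s < degree (p j)" by (rule block_cases)
    then show "f r = g r" using * by blast
  qed
qed simp

lemma sum_blocks:
  fixes f :: "nat \<Rightarrow> 'a::comm_monoid_add"
  shows "(\<Sum>r<n J. f r) = (\<Sum>j<J. \<Sum>s<degree (p j). f (n j + s))"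
  by (induction J) (simp_all add: n_Suc sum_lessThan_add)

section \<open>Action of \<open>H\<close> in block coordinates\<close>

lemma matrix_entry:
  assumes "s < degree (p j)" "t < degree (p i)"
  shows "gen_jacobi_matrix \<epsilon> p b (n j + s) (n i + t) = jacobi_block \<epsilon> p b j i $$ (s, t)"
  using assms by (simp add: gen_jacobi_matrix_def block_of_eq)

lemma jacobi_block_entry:
  assumes "s < degree (p j)" "t < degree (p i)"
  shows "jacobi_block \<epsilon> p b j i $$ (s, t) =
    (if i = j then if Suc t = degree (p j) then - coeff (p j) s else if s = Suc t then 1 else 0
     else if Suc t = degree (p i) \<and> s = 0 then
       if j = Suc i then b i else if i = Suc j then \<epsilon> j * \<epsilon> i * b j else 0
     else 0)"
proof -
  have last: "t = degree (p i) - 1 \<longleftrightarrow> Suc t = degree (p i)"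
    using assms(2) by auto
  consider "i = j" | "j = Suc i" | "i = Suc j" | "i \<noteq> j" "j \<noteq> Suc i" "i \<noteq> Suc j" by blast
  then show ?thesis
    using assms last
    by cases (simp_all add: jacobi_block_def companion_matrix_def corner_matrix_def conj_commute)
qed

text \<open>Corner matrices and coefficient columns read only the last entry of a block, so the
  blocks interact through these values alone.\<close>

definition last_entry :: "(nat \<Rightarrow> complex) \<Rightarrow> nat \<Rightarrow> complex" where
  "last_entry w j = w (n (Suc j) - 1)"

lemma last_entry: "last_entry w j = w (n j + (degree (p j) - 1))"
  using deg_pos[of j] by (simp add: last_entry_def n_Suc)

lemma sum_corner:
  "(\<Sum>t<degree (p i). (if Suc t = degree (p i) then c else 0) * w (n i + t)) = c * last_entry w i"
proof -
  have "(\<Sum>t<degree (p i). (if Suc t = degree (p i) then c else 0) * w (n i + t)) =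
      (\<Sum>t<degree (p i). if t = degree (p i) - 1 then c * w (n i + t) else 0)"
    using deg_pos[of i] by (intro sum.cong) auto
  also have "\<dots> = c * last_entry w i"
    using deg_pos[of i] by (simp add: last_entry)
  finally show ?thesis .
qed

text \<open>A row in block \<open>j\<close> meets only the blocks \<open>j - 1\<close>,
  \<open>j\<close> and \<open>j + 1\<close>, and only the top row of the block sees the two
  neighbours.\<close>

lemma H_apply:
  assumes s: "s < degree (p j)"
  shows "H w (n j + s) =
    (if s = 0 then
       (if j = 0 then 0 else of_real (b (j - 1)) * last_entry w (j - 1))
       + of_real (\<epsilon> j * \<epsilon> (Suc j) * b j) * last_entry w (Suc j)
     else w (n j + (s - 1)))
    - of_real (coeff (p j) s) * last_entry w j"
proof -
  define G where "G = gen_jacobi_matrix \<epsilon> p b"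
  define Y where "Y i = (\<Sum>t<degree (p i). of_real (jacobi_block \<epsilon> p b j i $$ (s, t)) * w (n i + t))" for i
  have Y: "Y i = (\<Sum>t<degree (p i). of_real (G (n j + s) (n i + t)) * w (n i + t))" for i
    unfolding Y_def G_def using s by (intro sum.cong) (auto simp: matrix_entry)
  \<comment> \<open>Columns from block \<open>j + 2\<close> on vanish, which turns the series in
    \<open>matrix_operator\<close> into a finite sum.\<close>
  have zero: "G (n j + s) c = 0" if c: "c \<notin> {..<n (Suc (Suc j))}" for c
  proof -
    obtain i t where it: "c = n i + t" "t < degree (p i)" by (rule block_cases)
    then have "\<not> i < Suc (Suc j)"
      using c n_mono[of "Suc i" "Suc (Suc j)"] n_Suc[of i] by auto
    then show ?thesis
      using it s by (simp add: G_def matrix_entry jacobi_block_entry)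
  qed
  have "H w (n j + s) = (\<Sum>c<n (Suc (Suc j)). of_real (G (n j + s) c) * w c)"
    unfolding matrix_operator_def G_def[symmetric]
    by (rule suminf_finite) (use zero in auto)
  also have "\<dots> = (\<Sum>i<Suc (Suc j). Y i)"
    unfolding Y by (rule sum_blocks)
  also have "\<dots> = (\<Sum>i<j. Y i) + Y j + Y (Suc j)" by simp
  also have "Y (Suc j) = (if s = 0 then of_real (\<epsilon> j * \<epsilon> (Suc j) * b j) * last_entry w (Suc j) else 0)"
  proof -
    have "Y (Suc j) = (\<Sum>t<degree (p (Suc j)). (if Suc t = degree (p (Suc j)) then
        (if s = 0 then of_real (\<epsilon> j * \<epsilon> (Suc j) * b j) else 0) else 0) * w (n (Suc j) + t))"
      unfolding Y_def using s by (intro sum.cong) (auto simp: jacobi_block_entry)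
    then show ?thesis by (simp only: sum_corner) simp
  qed
  also have "Y j = (if s = 0 then 0 else w (n j + (s - 1))) - of_real (coeff (p j) s) * last_entry w j"
  proof -
    \<comment> \<open>Coefficient column plus subdiagonal. The two never meet since
      \<open>s < degree (p j)\<close>; for \<open>s = 0\<close> the truncated \<open>s - 1\<close>
      is 0, and the inner test removes that term.\<close>
    have "Y j = (\<Sum>t<degree (p j). (if Suc t = degree (p j) then - of_real (coeff (p j) s) else 0) * w (n j + t)
        + (if t = s - 1 then (if s = 0 then 0 else w (n j + t)) else 0))"
      unfolding Y_def
    proof (rule sum.cong)
      fix t assume "t \<in> {..<degree (p j)}"
      then show "of_real (jacobi_block \<epsilon> p b j j $$ (s, t)) * w (n j + t) =
          (if Suc t = degree (p j) then - of_real (coeff (p j) s) else 0) * w (n j + t)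
          + (if t = s - 1 then (if s = 0 then 0 else w (n j + t)) else 0)"
        using s by (cases s) (simp_all add: jacobi_block_entry)
    qed simp
    also have "\<dots> = - of_real (coeff (p j) s) * last_entry w j + (if s = 0 then 0 else w (n j + (s - 1)))"
      unfolding sum.distrib sum_corner using s by simp
    finally show ?thesis by simp
  qed
  also have "(\<Sum>i<j. Y i) = (if s = 0 then if j = 0 then 0 else of_real (b (j - 1)) * last_entry w (j - 1) else 0)"
  proof (cases j)
    case (Suc i)
    have "Y i = (\<Sum>t<degree (p i). (if Suc t = degree (p i) then
        (if s = 0 then of_real (b i) else 0) else 0) * w (n i + t))"
      unfolding Y_def using s Suc by (intro sum.cong) (auto simp: jacobi_block_entry)
    then have "Y i = (if s = 0 then of_real (b i) * last_entry w i else 0)"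
      by (simp only: sum_corner) simp
    moreover have "Y i' = 0" if "i' < i" for i'
      unfolding Y_def using s that Suc by (intro sum.neutral) (auto simp: jacobi_block_entry)
    ultimately show ?thesis using Suc by simp
  qed simp
  finally show ?thesis by simp
qed

text \<open>Substituting \<open>last_entry w = \<epsilon> u\<close> turns the top rows of the blocks into this
  symmetric scalar Jacobi operator with off-diagonal entries \<open>\<epsilon>\<^sub>j b\<^sub>j\<close>.\<close>

definition J :: "(nat \<Rightarrow> complex) \<Rightarrow> nat \<Rightarrow> complex" where
  "J u j = (if j = 0 then 0 else of_real (\<epsilon> (j - 1) * b (j - 1)) * u (j - 1))
    + of_real (\<epsilon> j * b j) * u (Suc j) - of_real (\<epsilon> j) * cpoly (p j) z * u j"

section \<open>Elimination inside a block\<close>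

definition reduced :: "(nat \<Rightarrow> complex) \<Rightarrow> nat \<Rightarrow> complex" where
  "reduced w j = of_real (\<epsilon> j) * last_entry w j"

text \<open>The block of \<open>f\<close> evaluated as a polynomial at \<open>z\<close>: this is the
  right-hand side left in the top row after the other rows of the block are eliminated.\<close>

definition moment :: "(nat \<Rightarrow> complex) \<Rightarrow> nat \<Rightarrow> complex" where
  "moment f j = (\<Sum>t<degree (p j). z ^ t * f (n j + t))"

text \<open>The index \<open>t\<close> may equal the degree. Then the \<open>f\<close> part is
  absent and the leading coefficient 1 leaves the last entry of the block.\<close>

definition block_rhs :: "(nat \<Rightarrow> complex) \<Rightarrow> (nat \<Rightarrow> complex) \<Rightarrow> nat \<Rightarrow> nat \<Rightarrow> complex" where
  "block_rhs u f j t = of_real (coeff (p j) t) * (of_real (\<epsilon> j) * u j)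
    + (if t < degree (p j) then f (n j + t) else 0)"

definition block_solution :: "(nat \<Rightarrow> complex) \<Rightarrow> (nat \<Rightarrow> complex) \<Rightarrow> nat \<Rightarrow> nat \<Rightarrow> complex" where
  "block_solution u f j s = (\<Sum>d<degree (p j) - s. z ^ d * block_rhs u f j (Suc s + d))"

lemma sign_sq [simp]: "\<epsilon> j * \<epsilon> j = 1"
  using sign[of j] by auto

lemma sign_cancel [simp]: "of_real (\<epsilon> j) * (of_real (\<epsilon> j) * x) = (x :: complex)"
  by (metis mult.assoc mult_1 of_real_1 of_real_mult sign_sq)

lemma abs_sign [simp]: "\<bar>\<epsilon> j\<bar> = 1"
  using sign[of j] by auto

text \<open>The complete Horner sum reassembles the polynomial; this is how
  \<open>cpoly (p j) z\<close> arises from the companion matrix.\<close>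

lemma sum_block_rhs:
  "(\<Sum>t\<le>degree (p j). z ^ t * block_rhs u f j t) = of_real (\<epsilon> j) * u j * cpoly (p j) z + moment f j"
proof -
  have "(\<Sum>t\<le>degree (p j). z ^ t * block_rhs u f j t) =
     (\<Sum>t\<le>degree (p j). of_real (\<epsilon> j) * u j * (of_real (coeff (p j) t) * z ^ t)) +
     (\<Sum>t\<le>degree (p j). z ^ t * (if t < degree (p j) then f (n j + t) else 0))"
    by (simp add: block_rhs_def sum.distrib[symmetric] algebra_simps)
  also have "(\<Sum>t\<le>degree (p j). of_real (\<epsilon> j) * u j * (of_real (coeff (p j) t) * z ^ t)) =
      of_real (\<epsilon> j) * u j * cpoly (p j) z"
    by (simp add: cpoly_def poly_altdef coeff_map_poly degree_map_poly sum_distrib_left)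
  also have "(\<Sum>t\<le>degree (p j). z ^ t * (if t < degree (p j) then f (n j + t) else 0)) = moment f j"
    unfolding moment_def lessThan_Suc_atMost[symmetric] sum.lessThan_Suc by simp
  finally show ?thesis .
qed

text \<open>Within a block, the rows below the top one are the Horner recursion for all entries but
  the last. Inserting its solution into the top row yields the equation for
  \<open>J\<close>.\<close>

lemma resolvent_equation_iff:
  "(\<lambda>r. H w r - z * w r) = f \<longleftrightarrow>
    (\<forall>j. J (reduced w) j = moment f j) \<and>
    (\<forall>j. \<forall>s<degree (p j). w (n j + s) = block_solution (reduced w) f j s)"
    (is "?L \<longleftrightarrow> ?R")
proof -
  \<comment> \<open>\<open>E\<close> is a row of the resolvent equation, \<open>D\<close> a step of
    the recursion. Row \<open>Suc s\<close> carries step \<open>s\<close>, so the top row is left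
    over for \<open>J\<close>.\<close>
  define E where "E j s \<longleftrightarrow> H w (n j + s) - z * w (n j + s) = f (n j + s)" for j s
  define D where "D j s \<longleftrightarrow> w (n j + s) = block_rhs (reduced w) f j (Suc s)
      + (if Suc s < degree (p j) then z * w (n j + Suc s) else 0)" for j s
  have x: "of_real (\<epsilon> j) * reduced w j = last_entry w j" for j
    by (simp add: reduced_def)
  \<comment> \<open>The step at the last entry is an identity because \<open>p j\<close> is monic,
    which makes up for there being one row too few.\<close>
  have D_last: "D j (degree (p j) - 1)" for j
  proof -
    obtain k where k: "degree (p j) = Suc k"
      using deg_pos[of j] by (metis Suc_pred less_eq_Suc_le One_nat_def)
    then have "coeff (p j) (Suc k) = 1" using lead[of j] by simp
    then show ?thesis
      unfolding D_def block_rhs_def x using k by (simp add: last_entry)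
  qed
  have E_Suc: "E j (Suc s) \<longleftrightarrow> D j s" if "Suc s < degree (p j)" for j s
  proof -
    have "H w (n j + Suc s) = w (n j + s) - of_real (coeff (p j) (Suc s)) * last_entry w j"
      using H_apply[OF that] by simp
    then show ?thesis
      using that unfolding E_def D_def block_rhs_def x by (auto simp: diff_eq_eq add_ac)
  qed
  have D_iff: "(\<forall>s<degree (p j). D j s) \<longleftrightarrow>
      (\<forall>s<degree (p j). w (n j + s) = block_solution (reduced w) f j s)" for j
    unfolding D_def block_solution_def
    using horner_iff[of "degree (p j)" "\<lambda>s. w (n j + s)" "block_rhs (reduced w) f j" z] .
  have E_0: "E j 0 \<longleftrightarrow> J (reduced w) j = moment f j" if "\<forall>s<degree (p j). D j s" for j
  proof -
    obtain k where k: "degree (p j) = Suc k"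
      using deg_pos[of j] by (metis Suc_pred less_eq_Suc_le One_nat_def)
    have "w (n j) = block_solution (reduced w) f j 0"
      using that D_iff[of j] k by (metis add_0_right zero_less_Suc)
    \<comment> \<open>The top row supplies the missing term of index 0, completing the Horner sum to
      the whole polynomial.\<close>
    then have "block_rhs (reduced w) f j 0 + z * w (n j) =
        (\<Sum>t\<le>degree (p j). z ^ t * block_rhs (reduced w) f j t)"
      unfolding lessThan_Suc_atMost[symmetric] sum.lessThan_Suc_shift block_solution_def
      by (simp add: sum_distrib_left mult.assoc)
    then have "of_real (coeff (p j) 0) * last_entry w j + f (n j) + z * w (n j) =
        last_entry w j * cpoly (p j) z + moment f j"
      unfolding sum_block_rhs x by (simp add: block_rhs_def x k)
    then have m: "moment f j = of_real (coeff (p j) 0) * last_entry w j + f (n j) + z * w (n j)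
        - last_entry w j * cpoly (p j) z"
      by (simp add: algebra_simps)
    have J: "J (reduced w) j =
        (if j = 0 then 0 else of_real (b (j - 1)) * last_entry w (j - 1))
       + of_real (\<epsilon> j * \<epsilon> (Suc j) * b j) * last_entry w (Suc j) - cpoly (p j) z * last_entry w j"
      by (simp add: J_def reduced_def mult_ac)
    have H: "H w (n j) = (if j = 0 then 0 else of_real (b (j - 1)) * last_entry w (j - 1))
       + of_real (\<epsilon> j * \<epsilon> (Suc j) * b j) * last_entry w (Suc j) - of_real (coeff (p j) 0) * last_entry w j"
      using H_apply[of 0 j w] k by simp
    have "J (reduced w) j - moment f j = H w (n j) - z * w (n j) - f (n j)"
      unfolding m J H by (simp add: algebra_simps)
    then show ?thesis
      unfolding E_def by (metis add_0_right eq_iff_diff_eq_0)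
  qed
  have "?L \<longleftrightarrow> (\<forall>j. \<forall>s<degree (p j). E j s)"
    unfolding E_def by (rule fun_eq_blocks)
  also have "\<dots> \<longleftrightarrow> (\<forall>j. E j 0 \<and> (\<forall>s<degree (p j). D j s))"
  proof (intro all_cong1 iffI conjI allI impI)
    fix j assume "\<forall>s<degree (p j). E j s"
    then show "E j 0" using deg_pos[of j] by simp
  next
    fix j s assume "\<forall>s<degree (p j). E j s" "s < degree (p j)"
    then show "D j s"
      using E_Suc[of s j] D_last[of j] by (cases "Suc s < degree (p j)") (auto simp: not_less le_eq_less_or_eq)
  next
    fix j s assume "E j 0 \<and> (\<forall>s<degree (p j). D j s)" "s < degree (p j)"
    then show "E j s" using E_Suc by (cases s) auto
  qed
  also have "\<dots> \<longleftrightarrow> ?R" using E_0 D_iff by blast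
  finally show ?thesis .
qed

definition solution :: "(nat \<Rightarrow> complex) \<Rightarrow> (nat \<Rightarrow> complex) \<Rightarrow> nat \<Rightarrow> complex" where
  "solution u f r = block_solution u f (block_of p r) (r - n (block_of p r))"

lemma solution_block: "s < degree (p j) \<Longrightarrow> solution u f (n j + s) = block_solution u f j s"
  by (simp add: solution_def block_of_eq)

text \<open>At the last entry of a block only the leading coefficient 1 contributes, and the two
  signs cancel. Hence \<open>u\<close> can be prescribed freely, whatever \<open>f\<close>
  is.\<close>

lemma reduced_solution: "reduced (solution u f) = u"
proof
  fix j
  obtain k where k: "degree (p j) = Suc k"
    using deg_pos[of j] by (metis Suc_pred less_eq_Suc_le One_nat_def)
  then have "coeff (p j) (Suc k) = 1" using lead[of j] by simp
  then show "reduced (solution u f) j = u j"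
    unfolding reduced_def last_entry using k
    by (simp add: solution_block block_solution_def block_rhs_def)
qed

lemma solution_solves:
  assumes "\<And>j. J u j = moment f j"
  shows "(\<lambda>r. H (solution u f) r - z * solution u f r) = f"
  unfolding resolvent_equation_iff reduced_solution using assms by (simp add: solution_block)

subsection \<open>Norm estimates for the block reduction\<close>

text \<open>The norm of l1 type within a block: one number per block that dominates each entry and
  suits the scalar estimates.\<close>

definition block_sum :: "(nat \<Rightarrow> complex) \<Rightarrow> nat \<Rightarrow> real" where
  "block_sum w j = (\<Sum>t<degree (p j). cmod (w (n j + t)))"

lemma block_sum_nonneg: "0 \<le> block_sum w j"
  by (simp add: block_sum_def sum_nonneg)

lemma cmod_le_block_sum: "s < degree (p j) \<Longrightarrow> cmod (w (n j + s)) \<le> block_sum w j"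
  unfolding block_sum_def by (rule member_le_sum) auto

lemma L2_set_blocks:
  "L2_set (\<lambda>j. L2_set (\<lambda>t. v (n j + t)) {..<degree (p j)}) {..<m} = L2_set v {..<n m}"
  unfolding L2_set_def by (simp add: sum_blocks sum_nonneg)

text \<open>Cauchy-Schwarz against the constant 1 in each block, which has at most \<open>N\<close>
  entries.\<close>

lemma l2_bound_block_sum:
  assumes "l2_bound (\<lambda>r. cmod (w r)) K"
  shows "l2_bound (block_sum w) (sqrt N * K)"
  unfolding l2_bound_def
proof
  fix m
  have le: "block_sum w j \<le> sqrt N * L2_set (\<lambda>t. cmod (w (n j + t))) {..<degree (p j)}" for j
  proof -
    have "block_sum w j \<le> L2_set (\<lambda>t. cmod (w (n j + t))) {..<degree (p j)} * sqrt (degree (p j))"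
      using L2_set_mult_ineq[of "\<lambda>t. cmod (w (n j + t))" "\<lambda>_. 1" "{..<degree (p j)}"]
      by (simp add: block_sum_def L2_set_constant)
    also have "\<dots> \<le> L2_set (\<lambda>t. cmod (w (n j + t))) {..<degree (p j)} * sqrt N"
      using deg_le[of j] by (intro mult_left_mono) auto
    finally show ?thesis by (simp add: mult.commute)
  qed
  have "L2_set (block_sum w) {..<m} \<le>
      L2_set (\<lambda>j. sqrt N * L2_set (\<lambda>t. cmod (w (n j + t))) {..<degree (p j)}) {..<m}"
    by (intro L2_set_mono le block_sum_nonneg)
  also have "\<dots> = sqrt N * L2_set (\<lambda>r. cmod (w r)) {..<n m}"
    by (simp add: L2_set_right_distrib[symmetric] L2_set_blocks[of "\<lambda>r. cmod (w r)"])
  also have "\<dots> \<le> sqrt N * K"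
    using assms by (intro mult_left_mono) (auto simp: l2_bound_def)
  finally show "L2_set (block_sum w) {..<m} \<le> sqrt N * K" .
qed

lemma l2_bound_blockwise:
  assumes "l2_bound v K" and w: "\<And>j s. s < degree (p j) \<Longrightarrow> cmod (w (n j + s)) \<le> v j"
  shows "l2_bound (\<lambda>r. cmod (w r)) (sqrt N * K)"
  unfolding l2_bound_def
proof
  fix m
  have v: "0 \<le> v j" for j
    using w[of 0 j] deg_pos[of j] by (simp add: order_trans[OF norm_ge_zero])
  have le: "L2_set (\<lambda>t. cmod (w (n j + t))) {..<degree (p j)} \<le> sqrt N * v j" for j
  proof -
    have "L2_set (\<lambda>t. cmod (w (n j + t))) {..<degree (p j)} \<le> L2_set (\<lambda>t. v j) {..<degree (p j)}"
      by (intro L2_set_mono w) auto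
    also have "\<dots> = sqrt (degree (p j)) * v j" using v by (simp add: L2_set_constant)
    also have "\<dots> \<le> sqrt N * v j" using deg_le[of j] v by (intro mult_right_mono) auto
    finally show ?thesis .
  qed
  \<comment> \<open>The first \<open>m\<close> rows lie in the first \<open>m\<close> blocks, as no
    block is empty.\<close>
  have "L2_set (\<lambda>r. cmod (w r)) {..<m} \<le> L2_set (\<lambda>r. cmod (w r)) {..<n m}"
    unfolding L2_set_def using n_ge[of m] by (intro real_sqrt_le_mono sum_mono2) auto
  also have "\<dots> = L2_set (\<lambda>j. L2_set (\<lambda>t. cmod (w (n j + t))) {..<degree (p j)}) {..<m}"
    by (rule L2_set_blocks[of "\<lambda>r. cmod (w r)", symmetric])
  also have "\<dots> \<le> L2_set (\<lambda>j. sqrt N * v j) {..<m}"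
    by (intro L2_set_mono le L2_set_nonneg)
  also have "\<dots> = sqrt N * L2_set v {..<m}"
    by (simp add: L2_set_right_distrib)
  also have "\<dots> \<le> sqrt N * K"
    using assms(1) by (intro mult_left_mono) (auto simp: l2_bound_def)
  finally show "L2_set (\<lambda>r. cmod (w r)) {..<m} \<le> sqrt N * K" .
qed

lemma l2_bound_reduced:
  assumes "l2_bound (\<lambda>r. cmod (w r)) K"
  shows "l2_bound (\<lambda>j. cmod (reduced w j)) (sqrt N * K)"
proof (rule l2_bound_mono[OF l2_bound_block_sum[OF assms]])
  fix j show "cmod (reduced w j) \<le> block_sum w j"
    unfolding reduced_def last_entry using deg_pos[of j] cmod_le_block_sum[of "degree (p j) - 1" j w]
    by (simp add: norm_mult)
qed simp

definition zbound :: real where "zbound = max 1 (cmod z) ^ N"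

lemma zbound_ge_1: "1 \<le> zbound"
  unfolding zbound_def by (simp add: one_le_power)

lemma cmod_power_le: "d \<le> N \<Longrightarrow> cmod z ^ d \<le> zbound"
  unfolding zbound_def
  by (rule order_trans[OF power_mono[of _ "max 1 (cmod z)"] power_increasing]) auto

lemma cmod_moment_le: "cmod (moment f j) \<le> zbound * block_sum f j"
  unfolding moment_def block_sum_def sum_distrib_left using deg_le[of j]
  by (intro sum_norm_le) (auto simp: norm_mult norm_power intro!: mult_right_mono cmod_power_le)

text \<open>At most \<open>N\<close> Horner terms, each with a power of \<open>z\<close> below
  \<open>zbound\<close> and a coefficient below \<open>max 1 M\<close>, where 1 covers the leading
  coefficient.\<close>

definition solution_const :: real where "solution_const = real N * zbound * max 1 M"

lemma solution_const_nonneg: "0 \<le> solution_const"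
  unfolding solution_const_def using zbound_ge_1 by simp

lemma cmod_block_solution_le:
  "cmod (block_solution u f j s) \<le> solution_const * (cmod (u j) + block_sum f j)"
proof -
  let ?B = "max 1 M" and ?k = "degree (p j)"
  let ?X = "?B * (cmod (u j) + block_sum f j)"
  have X: "0 \<le> ?X" by (simp add: block_sum_nonneg)
  have rhs: "cmod (block_rhs u f j t) \<le> ?X" if "t \<le> ?k" for t
  proof -
    have "\<bar>coeff (p j) t\<bar> \<le> ?B"
      using that lead[of j] coeff_le[of t j] by (cases "t = ?k") auto
    then have "cmod (block_rhs u f j t) \<le> ?B * cmod (u j) + block_sum f j"
      unfolding block_rhs_def
      by (intro order_trans[OF norm_triangle_ineq] add_mono)
        (auto simp: norm_mult cmod_le_block_sum block_sum_nonneg intro!: mult_right_mono)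
    also have "\<dots> \<le> ?X"
      using mult_right_mono[OF max.cobounded1[of 1 M] block_sum_nonneg[of f j]]
      by (simp add: distrib_left)
    finally show ?thesis .
  qed
  have "cmod (block_solution u f j s) \<le> (\<Sum>d<?k - s. zbound * ?X)"
    unfolding block_solution_def
  proof (rule sum_norm_le)
    fix d assume "d \<in> {..<?k - s}"
    then show "cmod (z ^ d * block_rhs u f j (Suc s + d)) \<le> zbound * ?X"
      unfolding norm_mult norm_power using deg_le[of j] zbound_ge_1
      by (intro mult_mono cmod_power_le rhs) auto
  qed
  also have "\<dots> = real (?k - s) * (zbound * ?X)" by simp
  also have "\<dots> \<le> real N * (zbound * ?X)"
    using deg_le[of j] zbound_ge_1 X by (intro mult_right_mono) auto
  finally show ?thesis by (simp add: solution_const_def mult.assoc)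
qed

lemma l2_bound_solution:
  assumes "l2_bound (\<lambda>j. cmod (u j)) K" "l2_bound (block_sum f) L"
  shows "l2_bound (\<lambda>r. cmod (solution u f r)) (sqrt N * (solution_const * (K + L)))"
  by (rule l2_bound_blockwise[OF l2_bound_mult[OF l2_bound_add[OF assms] solution_const_nonneg]])
    (simp add: solution_block cmod_block_solution_le)

text \<open>A right inverse of \<open>moment\<close>: it lifts an arbitrary right-hand side of the
  scalar equation to one for \<open>H\<close>.\<close>

definition top_embedding :: "(nat \<Rightarrow> complex) \<Rightarrow> nat \<Rightarrow> complex" where
  "top_embedding g r = (if r = n (block_of p r) then g (block_of p r) else 0)"

lemma top_embedding_block:
  "s < degree (p j) \<Longrightarrow> top_embedding g (n j + s) = (if s = 0 then g j else 0)"
  using block_of_eq[of 0 j] deg_pos[of j] by (auto simp: top_embedding_def block_of_eq)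

lemma moment_top_embedding: "moment (top_embedding g) j = g j"
proof -
  have "moment (top_embedding g) j = (\<Sum>t<degree (p j). if t = 0 then g j else 0)"
    unfolding moment_def by (intro sum.cong) (auto simp: top_embedding_block)
  then show ?thesis using deg_pos[of j] by simp
qed

lemma l2_bound_top_embedding:
  "l2_bound (\<lambda>j. cmod (g j)) K \<Longrightarrow> l2_bound (\<lambda>r. cmod (top_embedding g r)) (sqrt N * K)"
  by (erule l2_bound_blockwise) (simp add: top_embedding_block)

subsection \<open>The scalar Jacobi operator\<close>

abbreviation P :: "nat \<Rightarrow> complex" where "P j \<equiv> jacobi_P \<epsilon> p b j z"
abbreviation Q :: "nat \<Rightarrow> complex" where "Q j \<equiv> jacobi_Q \<epsilon> p b j z"
abbreviation a :: "nat \<Rightarrow> complex" where "a j \<equiv> of_real (\<epsilon> j * b j)"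

lemma cmod_a: "cmod (a j) = b j"
  using b_pos[of j] by (simp add: norm_mult)

lemma J_0: "J u 0 = a 0 * u 1 - of_real (\<epsilon> 0) * cpoly (p 0) z * u 0"
  by (simp add: J_def)

lemma J_Suc: "J u (Suc j) = a j * u j + a (Suc j) * u (Suc (Suc j))
    - of_real (\<epsilon> (Suc j)) * cpoly (p (Suc j)) z * u (Suc j)"
  by (simp add: J_def)

lemma J_mult: "J (\<lambda>i. c * u i) j = c * J u j"
  by (simp add: J_def algebra_simps)

lemma J_cong:
  "u j = v j \<Longrightarrow> u (Suc j) = v (Suc j) \<Longrightarrow> (\<And>i. j = Suc i \<Longrightarrow> u i = v i) \<Longrightarrow> J u j = J v j"
  by (cases j) (simp_all add: J_def)

lemma J_0_iff: "J u 0 = c \<longleftrightarrow> u (Suc 0) = (cpoly (p 0) z * u 0 + of_real (\<epsilon> 0) * c) / of_real (b 0)"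
proof -
  have "J u 0 = of_real (\<epsilon> 0) * (of_real (b 0) * u (Suc 0) - cpoly (p 0) z * u 0)"
    by (simp add: J_0 algebra_simps)
  then have "J u 0 = c \<longleftrightarrow> of_real (b 0) * u (Suc 0) - cpoly (p 0) z * u 0 = of_real (\<epsilon> 0) * c"
    by (metis sign_cancel)
  then show ?thesis using b_pos[of 0] by (auto simp: field_simps)
qed

text \<open>Multiplying by the sign undoes the symmetrization and gives back the three-term
  recurrence.\<close>

lemma J_Suc_eq_sign:
  "of_real (\<epsilon> (Suc j)) * J u (Suc j) = of_real (\<epsilon> j * \<epsilon> (Suc j) * b j) * u j
    - cpoly (p (Suc j)) z * u (Suc j) + of_real (b (Suc j)) * u (Suc (Suc j))"
  by (simp add: J_Suc algebra_simps)

lemma J_Suc_iff: "J u (Suc j) = 0 \<longleftrightarrow> of_real (\<epsilon> j * \<epsilon> (Suc j) * b j) * u j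
    - cpoly (p (Suc j)) z * u (Suc j) + of_real (b (Suc j)) * u (Suc (Suc j)) = 0"
  unfolding J_Suc_eq_sign[symmetric] using sign[of "Suc j"] by auto

lemma J_Suc_iff': "J u (Suc j) = 0 \<longleftrightarrow> u (Suc (Suc j)) =
    (cpoly (p (Suc j)) z * u (Suc j) - of_real (\<epsilon> j * \<epsilon> (Suc j) * b j) * u j) / of_real (b (Suc j))"
  unfolding J_Suc_iff using b_pos[of "Suc j"] by (auto simp: field_simps)

lemma jacobi_recurrence_iff: "jacobi_recurrence \<epsilon> p b z u \<longleftrightarrow> (\<forall>j. J u (Suc j) = 0)"
proof -
  have "(\<forall>j\<ge>1. R j) \<longleftrightarrow> (\<forall>j. R (Suc j))" for R :: "nat \<Rightarrow> bool"
    by (auto simp: Suc_le_eq gr0_conv_Suc)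
  then show ?thesis unfolding jacobi_recurrence_def J_Suc_iff by simp
qed

lemma J_P: "J P j = 0"
  by (cases j) (simp_all add: J_0_iff J_Suc_iff')

text \<open>The initial values of \<open>Q\<close> are normalized so that row 0 gives exactly 1. A
  Weyl solution is thus the first column of the inverse of \<open>J\<close>.\<close>

lemma J_Weyl: "J (\<lambda>j. Q j + m * P j) j = (if j = 0 then 1 else 0)"
proof -
  have "J (\<lambda>j. Q j + m * P j) j = J Q j + m * J P j"
    by (simp add: J_def algebra_simps)
  moreover have "J Q j = (if j = 0 then 1 else 0)"
    by (cases j) (simp_all add: J_0_iff J_Suc_iff')
  ultimately show ?thesis by (simp add: J_P)
qed

text \<open>Row 0 fixes \<open>u 1\<close>, and each later row fixes the next value since
  \<open>b j\<close> is nonzero, so \<open>c\<close> and \<open>u 0\<close> determine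
  everything.\<close>

lemma J_unique:
  assumes "J u 0 = c" "\<And>j. J u (Suc j) = 0"
  shows "u j = c * Q j + u 0 * P j"
proof (induction j rule: induct_nat_012)
  case 1
  then show ?case using assms(1) by (simp add: J_0_iff add_divide_distrib mult.commute)
next
  case (ge2 j)
  then show ?case
    unfolding assms(2)[of j, unfolded J_Suc_iff'] ge2.IH jacobi_P.simps jacobi_Q.simps
    by (simp add: divide_inverse algebra_simps)
qed simp

section \<open>Wronskian and Green's function\<close>

text \<open>Consecutive Wronskians differ by \<open>P * J W - W * J P\<close>, which vanishes beyond
  row 0; in row 0 it equals 1.\<close>

lemma wronskian:
  assumes W: "\<And>j. J W j = (if j = 0 then 1 else 0)"
  shows "a j * (P j * W (Suc j) - P (Suc j) * W j) = 1"
proof (induction j)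
  case 0
  have "a 0 * (P 0 * W (Suc 0) - P (Suc 0) * W 0) = P 0 * J W 0 - W 0 * J P 0"
    unfolding J_0 by (simp add: algebra_simps)
  then show ?case by (simp only: W J_P) simp
next
  case (Suc j)
  have "a (Suc j) * (P (Suc j) * W (Suc (Suc j)) - P (Suc (Suc j)) * W (Suc j)) =
      P (Suc j) * J W (Suc j) - W (Suc j) * J P (Suc j) + a j * (P j * W (Suc j) - P (Suc j) * W j)"
    unfolding J_Suc by (simp only: algebra_simps)
  then show ?case by (simp only: W J_P Suc.IH) simp
qed

text \<open>A kernel element is a multiple of \<open>P\<close>. If it were nonzero, \<open>P\<close>
  and \<open>W\<close> would both tend to 0, whereas the Wronskian and \<open>b j \<le> M\<close>
  keep \<open>P j * W (Suc j) - P (Suc j) * W j\<close> at least \<open>1 / M\<close> in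
  modulus.\<close>

lemma J_injective:
  assumes W: "\<And>j. J W j = (if j = 0 then 1 else 0)" "W \<in> l2"
    and u: "u \<in> l2" "\<And>j. J u j = 0"
  shows "u = (\<lambda>_. 0)"
proof -
  have uP: "u j = u 0 * P j" for j
    using J_unique[OF u(2) u(2), of j] by (simp only: mult_zero_left add_0_left)
  have "u 0 = 0"
  proof (rule ccontr)
    assume "u 0 \<noteq> 0"
    then have "P = (\<lambda>j. u j / u 0)" using uP by (metis nonzero_mult_div_cancel_left)
    moreover have "(\<lambda>j. u j / u 0) \<longlonglongrightarrow> 0 / u 0"
      using \<open>u 0 \<noteq> 0\<close> by (intro tendsto_divide l2_tendsto_0 u tendsto_const)
    ultimately have P: "P \<longlonglongrightarrow> 0" by simp
    have "(\<lambda>j. P j * W (Suc j) - P (Suc j) * W j) \<longlonglongrightarrow> 0 * 0 - 0 * 0"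
      by (intro tendsto_diff tendsto_mult P l2_tendsto_0[OF W(2)] LIMSEQ_Suc)
    then have lim: "(\<lambda>j. M * cmod (P j * W (Suc j) - P (Suc j) * W j)) \<longlonglongrightarrow> 0"
      by (intro tendsto_mult_right_zero tendsto_norm_zero) simp
    have ge: "1 \<le> M * cmod (P j * W (Suc j) - P (Suc j) * W j)" for j
    proof -
      have "1 = b j * cmod (P j * W (Suc j) - P (Suc j) * W j)"
        using arg_cong[OF wronskian[OF W(1), of j], of cmod] by (simp only: norm_mult cmod_a norm_one)
      also have "\<dots> \<le> M * cmod (P j * W (Suc j) - P (Suc j) * W j)"
        by (intro mult_right_mono b_le) simp
      finally show ?thesis .
    qed
    have "(1 :: real) \<le> 0" using ge by (intro LIMSEQ_le_const[OF lim]) blast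
    then show False by simp
  qed
  then show ?thesis using uP by (metis mult_zero_left)
qed

definition green :: "(nat \<Rightarrow> complex) \<Rightarrow> nat \<Rightarrow> nat \<Rightarrow> complex" where
  "green W k j = P (min j k) * W (max j k)"

text \<open>Off the diagonal, \<open>J\<close> sees locally a multiple of \<open>P\<close> or of
  \<open>W\<close>. On the diagonal, the change from one to the other contributes the
  Wronskian.\<close>

lemma J_green:
  assumes W: "\<And>j. J W j = (if j = 0 then 1 else 0)"
  shows "J (green W k) j = (if j = k then 1 else 0)"
proof -
  consider "j < k" | "k < j" | "j = k" by linarith
  then show ?thesis
  proof cases
    case 1
    then have "J (green W k) j = J (\<lambda>i. W k * P i) j"
      by (intro J_cong) (auto simp: green_def min_def max_def mult.commute)
    then show ?thesis using 1 by (simp add: J_mult J_P)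
  next
    case 2
    then have "J (green W k) j = J (\<lambda>i. P k * W i) j"
      by (intro J_cong) (auto simp: green_def min_def max_def less_Suc_eq)
    then show ?thesis using 2 by (simp only: J_mult W) simp
  next
    case 3
    have "J (green W k) k = W k * J P k + a k * (P k * W (Suc k) - P (Suc k) * W k)"
      by (cases k) (simp_all add: J_0 J_Suc green_def min_def max_def algebra_simps del: jacobi_P.simps)
    then show ?thesis using 3 by (simp only: J_P wronskian[OF W]) simp
  qed
qed

subsection \<open>Resolvent points\<close>

text \<open>Lifting \<open>J u\<close> by \<open>top_embedding\<close> makes \<open>u\<close> the
  reduced form of a solution of the resolvent equation for \<open>H\<close>, which the bounded
  inverse \<open>R\<close> controls.\<close>

lemma J_bounded_below:
  assumes R: "l2_bounded_operator R" "\<And>w. w \<in> l2 \<Longrightarrow> R (\<lambda>r. H w r - z * w r) = w"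
  obtains C where "0 < C"
    "\<And>u K. u \<in> l2 \<Longrightarrow> l2_bound (\<lambda>j. cmod (J u j)) K \<Longrightarrow> l2_norm u \<le> C * K"
proof -
  obtain L0 where L0: "\<And>v. v \<in> l2 \<Longrightarrow> l2_norm (R v) \<le> L0 * l2_norm v"
    using R(1) unfolding l2_bounded_operator_def by blast
  \<comment> \<open>The operator bound itself could be negative.\<close>
  define L where "L = max 0 L0"
  have L: "l2_norm (R v) \<le> L * l2_norm v" if "v \<in> l2" for v
  proof -
    have "L0 * l2_norm v \<le> L * l2_norm v"
      using l2_bound_nonneg[OF l2_bound_l2_norm[OF that]] by (intro mult_right_mono) (auto simp: L_def)
    then show ?thesis using L0[OF that] by linarith
  qed
  have L_nonneg: "0 \<le> L" by (simp add: L_def)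
  show thesis
  \<comment> \<open>Embedding and reduction cost a factor \<open>sqrt N\<close> each; the summand 1
    makes the constant positive.\<close>
  proof (rule that[of "real N * L + 1"])
    fix u K assume u: "u \<in> l2" and K: "l2_bound (\<lambda>j. cmod (J u j)) K"
    define f where "f = top_embedding (J u)"
    define w where "w = solution u f"
    have f: "l2_bound (\<lambda>r. cmod (f r)) (sqrt N * K)"
      unfolding f_def by (rule l2_bound_top_embedding[OF K])
    have w: "w \<in> l2"
      unfolding w_def
      by (rule l2_bound_in_l2[OF l2_bound_solution[OF l2_bound_l2_norm[OF u] l2_bound_block_sum[OF f]]])
    have "(\<lambda>r. H w r - z * w r) = f"
      unfolding w_def by (rule solution_solves) (simp add: f_def moment_top_embedding)
    then have "R f = w" using R(2)[OF w] by simp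
    then have "l2_norm w \<le> L * l2_norm f" using L[OF l2_bound_in_l2[OF f]] by simp
    also have "\<dots> \<le> L * (sqrt N * K)"
      by (intro mult_left_mono l2_bound_l2_norm_le f L_nonneg)
    finally have "sqrt N * l2_norm w \<le> sqrt N * (L * (sqrt N * K))"
      by (intro mult_left_mono) simp_all
    also have "\<dots> = (sqrt N * sqrt N) * L * K" by (simp only: mult_ac)
    also have "\<dots> = real N * L * K" by simp
    also have "\<dots> \<le> (real N * L + 1) * K"
      using l2_bound_nonneg[OF K] by (simp add: distrib_right)
    finally have "sqrt N * l2_norm w \<le> (real N * L + 1) * K" .
    moreover have "reduced w = u" unfolding w_def by (rule reduced_solution)
    then have "l2_norm u \<le> sqrt N * l2_norm w"
      using l2_bound_l2_norm_le[OF l2_bound_reduced[OF l2_bound_l2_norm[OF w]]] by simp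
    ultimately show "l2_norm u \<le> (real N * L + 1) * K" by linarith
  qed (use L_nonneg in \<open>simp add: add_nonneg_pos\<close>)
qed

text \<open>Combes--Thomas: a column of Green's function, multiplied by a slowly growing
  exponential weight, still solves the equation up to an error that the lower bound on \<open>J\<close>
  absorbs.  The weight is capped, so that the product is known to be square summable beforehand.\<close>

lemma green_decay:
  assumes W: "\<And>j. J W j = (if j = 0 then 1 else 0)" "W \<in> l2"
    and C: "0 < C" "\<And>u K. u \<in> l2 \<Longrightarrow> l2_bound (\<lambda>j. cmod (J u j)) K \<Longrightarrow> l2_norm u \<le> C * K"
  obtains \<rho> where "1 < \<rho>" "\<And>i j. i \<le> j \<Longrightarrow> \<rho> ^ (j - i) * cmod (P i * W j) \<le> 2 * C"
proof -
  have M: "0 < M" using b_pos[of 0] b_le[of 0] by linarith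
  \<comment> \<open>Chosen so that the errors from the two neighbours,
    \<open>2 * C * \<delta> * M\<close> in total, amount to one half.\<close>
  define \<delta> where "\<delta> = 1 / (4 * C * M)"
  define \<rho> where "\<rho> = 1 + \<delta>"
  have \<delta>: "0 < \<delta>" "C * (\<delta> * M) = 1 / 4" using M C(1) by (simp_all add: \<delta>_def)
  have \<rho>: "1 < \<rho>" using \<delta> by (simp add: \<rho>_def)
  show thesis
  proof (rule that[OF \<rho>])
    fix i j :: nat assume ij: "i \<le> j"
    \<comment> \<open>The weight is 1 up to \<open>i\<close> by truncated subtraction, grows by the
      factor \<open>\<rho>\<close> per step, and is constant from \<open>j\<close> on.\<close>
    define \<phi> where "\<phi> l = \<rho> ^ min (l - i) (j - i)" for l
    define v where "v l = of_real (\<phi> l) * green W i l" for l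
    have \<phi>_pos: "0 < \<phi> l" for l using \<rho> by (simp add: \<phi>_def)
    have \<phi>_mono: "\<phi> l \<le> \<phi> (Suc l)" for l
      unfolding \<phi>_def using \<rho> by (intro power_increasing) auto
    have \<phi>_diff: "\<phi> (Suc l) - \<phi> l \<le> \<delta> * \<phi> l" for l
    proof -
      have "\<phi> (Suc l) \<le> \<rho> ^ Suc (min (l - i) (j - i))"
        unfolding \<phi>_def using \<rho> by (intro power_increasing) auto
      then show ?thesis by (simp add: \<phi>_def \<rho>_def algebra_simps)
    qed
    have \<phi>_diff_left: "\<bar>\<phi> l - \<phi> (Suc l)\<bar> \<le> \<delta> * \<phi> l" for l
      using \<phi>_diff[of l] \<phi>_mono[of l] by simp
    have \<phi>_diff_right: "\<bar>\<phi> (Suc l) - \<phi> l\<bar> \<le> \<delta> * \<phi> (Suc l)" for l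
      using \<phi>_diff[of l] \<phi>_mono[of l] mult_left_mono[OF \<phi>_mono[of l], of \<delta>] \<delta>(1) by linarith
    have v: "v \<in> l2"
    proof (rule l2_comparison[OF W(2), of i v "\<rho> ^ (j - i) * cmod (P i)"])
      fix l assume "i \<le> l"
      then have "cmod (v l) = \<phi> l * cmod (P i) * cmod (W l)"
        using \<phi>_pos[of l] by (simp add: v_def green_def norm_mult min_def max_def)
      also have "\<dots> \<le> \<rho> ^ (j - i) * cmod (P i) * cmod (W l)"
        unfolding \<phi>_def using \<rho> by (intro mult_right_mono power_increasing) auto
      finally show "cmod (v l) \<le> \<rho> ^ (j - i) * cmod (P i) * cmod (W l)" .
    qed
    define V where "V = l2_norm v"
    have vV: "l2_bound (\<lambda>l. cmod (v l)) V" unfolding V_def by (rule l2_bound_l2_norm[OF v])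
    have off: "cmod (a k * (of_real (x - y) * g)) \<le> (\<delta> * M) * cmod (of_real x * g)"
      if "\<bar>x - y\<bar> \<le> \<delta> * x" "0 < x" for x y g k
    proof -
      have "cmod (a k * (of_real (x - y) * g)) = b k * (\<bar>x - y\<bar> * cmod g)"
        by (simp only: norm_mult cmod_a) (simp only: norm_of_real)
      also have "\<dots> \<le> M * (\<delta> * x * cmod g)"
        using b_le[of k] b_pos[of k] M that by (intro mult_mono) auto
      finally show ?thesis using that by (simp add: norm_mult mult_ac)
    qed
    have Jv: "cmod (J v l) \<le> (if l = i then 1 else 0)
        + ((\<delta> * M) * (if l = 0 then 0 else cmod (v (l - 1))) + (\<delta> * M) * cmod (v (Suc l)))" for l
    proof -
      let ?g = "green W i"
      have tri: "cmod (x + (y + y')) \<le> X + (Y + Y')"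
        if "cmod x = X" "cmod y \<le> Y" "cmod y' \<le> Y'" for x y y' X Y Y'
        using that by (intro order_trans[OF norm_triangle_ineq] add_mono) auto
      \<comment> \<open>The diagonal of \<open>J\<close> commutes with the weight, so only
        differences of neighbouring weights remain as commutator.\<close>
      have eq: "J v l = of_real (\<phi> l) * J ?g l
          + ((if l = 0 then 0 else a (l - 1) * (of_real (\<phi> (l - 1) - \<phi> l) * ?g (l - 1)))
            + a l * (of_real (\<phi> (Suc l) - \<phi> l) * ?g (Suc l)))"
        by (cases l) (simp_all add: J_0 J_Suc v_def algebra_simps)
      \<comment> \<open>The weight at \<open>i\<close> is 1, so the unit source is
        unchanged.\<close>
      have "cmod (of_real (\<phi> l) * J ?g l) = (if l = i then 1 else 0)"
        by (simp add: J_green[OF W(1)] \<phi>_def)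
      moreover have "cmod (if l = 0 then 0 else a (l - 1) * (of_real (\<phi> (l - 1) - \<phi> l) * ?g (l - 1)))
          \<le> (\<delta> * M) * (if l = 0 then 0 else cmod (v (l - 1)))"
        using off[OF \<phi>_diff_left \<phi>_pos] by (cases l) (simp_all add: v_def)
      moreover have "cmod (a l * (of_real (\<phi> (Suc l) - \<phi> l) * ?g (Suc l))) \<le> (\<delta> * M) * cmod (v (Suc l))"
        unfolding v_def by (rule off[OF \<phi>_diff_right \<phi>_pos])
      ultimately show ?thesis
        unfolding eq by (rule tri)
    qed
    have \<delta>M: "0 \<le> \<delta> * M" using \<delta> M by simp
    have "l2_bound (\<lambda>l. cmod (J v l)) (1 + ((\<delta> * M) * V + (\<delta> * M) * V))"
      by (rule l2_bound_mono[OF l2_bound_add[OF l2_bound_unit[of i]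
          l2_bound_add[OF l2_bound_mult[OF l2_bound_pred[OF vV] \<delta>M] l2_bound_mult[OF l2_bound_Suc[OF vV] \<delta>M]]]])
        (use Jv in auto)
    \<comment> \<open>This reads \<open>V \<le> C + V / 2\<close>; as \<open>V\<close> is a real
      number, it can be absorbed.\<close>
    from C(2)[OF v this] have "V \<le> C + 2 * (C * (\<delta> * M)) * V"
      unfolding V_def[symmetric] by (simp add: algebra_simps)
    then have "V \<le> 2 * C" unfolding \<delta>(2) by simp
    moreover have "cmod (v j) \<le> V" by (rule l2_bound_component[OF vV])
    moreover have "cmod (v j) = \<rho> ^ (j - i) * cmod (P i * W j)"
      using ij \<rho> by (simp add: v_def \<phi>_def green_def norm_mult norm_power min_def max_def)
    ultimately show "\<rho> ^ (j - i) * cmod (P i * W j) \<le> 2 * C" by linarith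
  qed
qed

text \<open>The Weyl solution consists of the signed last entries of the resolvent applied to the
  unit vector of row 0; \<open>green_decay\<close> then gives decay in the block index.\<close>

lemma weyl_solution_of_resolvent:
  assumes "z \<in> resolvent_set H"
  obtains W q C where "weyl_solution \<epsilon> p b z W" "0 < q" "q < 1" "0 < C"
    "\<And>i j. i \<le> j \<Longrightarrow> cmod (P i * W j) \<le> C * q ^ (n j - n i)"
proof -
  obtain R where R: "l2_bounded_operator R"
      and left: "\<And>w. w \<in> l2 \<Longrightarrow> R (\<lambda>r. H w r - z * w r) = w"
      and right: "\<And>w. w \<in> l2 \<Longrightarrow> (\<lambda>r. H (R w) r - z * R w r) = w"
    using assms unfolding resolvent_set_def by blast
  define f where "f = top_embedding (\<lambda>j. if j = 0 then 1 else 0)"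
  have "l2_bound (\<lambda>j. cmod (if j = 0 then 1 else 0)) 1"
    using l2_bound_unit[of 0] by (simp add: if_distrib[of cmod] cong: if_cong)
  then have f: "f \<in> l2"
    unfolding f_def by (rule l2_bound_in_l2[OF l2_bound_top_embedding])
  define W where "W = reduced (R f)"
  have Rf: "R f \<in> l2" using R f unfolding l2_bounded_operator_def by blast
  have W: "W \<in> l2"
    unfolding W_def by (rule l2_bound_in_l2[OF l2_bound_reduced[OF l2_bound_l2_norm[OF Rf]]])
  have JW: "J W j = (if j = 0 then 1 else 0)" for j
    using right[OF f] unfolding resolvent_equation_iff W_def by (simp add: f_def moment_top_embedding)
  have J0: "J W 0 = 1" and J_Suc: "J W (Suc j) = 0" for j using JW by simp_all
  have "W j = Q j + W 0 * P j" for j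
    using J_unique[OF J0 J_Suc, of j] by (simp only: mult_1_left)
  with W J_Suc have weyl: "weyl_solution \<epsilon> p b z W"
    unfolding weyl_solution_def jacobi_recurrence_iff by (intro conjI allI exI[of _ "W 0"])
  obtain C where C: "0 < C"
    "\<And>u K. u \<in> l2 \<Longrightarrow> l2_bound (\<lambda>j. cmod (J u j)) K \<Longrightarrow> l2_norm u \<le> C * K"
    using J_bounded_below[OF R left] by blast
  obtain \<rho> where \<rho>: "1 < \<rho>" "\<And>i j. i \<le> j \<Longrightarrow> \<rho> ^ (j - i) * cmod (P i * W j) \<le> 2 * C"
    using green_decay[OF JW W C] by blast
  have N: "0 < N" using deg_pos[of 0] deg_le[of 0] by simp
  \<comment> \<open>The root compensates for blocks of up to \<open>N\<close> rows:
    \<open>\<rho>\<close> to the power \<open>-(j - i)\<close> is \<open>q ^ (N * (j - i))\<close>,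
    and \<open>n j - n i \<le> N * (j - i)\<close>.\<close>
  define q where "q = root N (1 / \<rho>)"
  have q: "0 < q" "q < 1" and qN: "q ^ N = 1 / \<rho>"
    using \<rho>(1) N by (simp_all add: q_def)
  have "cmod (P i * W j) \<le> 2 * C * q ^ (n j - n i)" if "i \<le> j" for i j
  proof -
    have "cmod (P i * W j) \<le> 2 * C / \<rho> ^ (j - i)"
      using \<rho>(2)[OF that] \<rho>(1) by (simp add: pos_le_divide_eq mult.commute)
    also have "\<dots> = 2 * C * q ^ (N * (j - i))"
      by (simp add: power_mult qN power_divide)
    also have "\<dots> \<le> 2 * C * q ^ (n j - n i)"
      using q C(1) n_diff_le[OF that] by (intro mult_left_mono power_decreasing) auto
    finally show ?thesis .
  qed
  then show thesis using C(1) by (intro that[OF weyl q, of "2 * C"]) auto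
qed

section \<open>From exponential decay to a bounded inverse\<close>

text \<open>Green's kernel is applied to \<open>g\<close> and split at the diagonal. The past and
  future parts are dominated by geometric convolutions of \<open>cmod (g j)\<close>.\<close>

lemma green_solve:
  assumes W: "\<And>j. J W j = (if j = 0 then 1 else 0)"
    and dec: "\<And>i j. i \<le> j \<Longrightarrow> cmod (P i * W j) \<le> C * q ^ (j - i)"
    and q: "0 < q" "q < 1" and C: "0 < C"
    and g: "l2_bound (\<lambda>j. cmod (g j)) K"
  obtains u where "\<And>j. J u j = g j" "l2_bound (\<lambda>j. cmod (u j)) ((C / (1 - q) + C / (1 - q)\<^sup>2) * K)"
proof -
  \<comment> \<open>\<open>S\<close> includes the diagonal term and \<open>T\<close> starts just
    after it, so that it is counted once.\<close>
  define S where "S i = (\<Sum>j\<le>i. P j * g j)" for i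
  define T where "T i = (\<Sum>d. W (Suc i + d) * g (Suc i + d))" for i
  define u where "u i = W i * S i + P i * T i" for i
  define A where "A i = (\<Sum>j\<le>i. q ^ (i - j) * cmod (g j))" for i
  define B where "B i = (\<Sum>d. q ^ d * cmod (g (i + d)))" for i
  have K: "cmod (g i) \<le> K" for i by (rule l2_bound_component[OF g])
  have qs: "summable (\<lambda>d. q ^ d * K)"
    using q by (intro summable_mult2 summable_geometric) simp
  have sB: "summable (\<lambda>d. q ^ d * cmod (g (i + d)))" for i
    by (rule summable_comparison_test'[OF qs, of 0]) (use q K in \<open>simp add: mult_left_mono\<close>)
  have PW: "cmod (P i * (W (i + d) * g (i + d))) \<le> C * (q ^ d * cmod (g (i + d)))" for i d
    using mult_right_mono[OF dec[of i "i + d"] norm_ge_zero[of "g (i + d)"]]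
    by (simp add: norm_mult mult.assoc)
  \<comment> \<open>One factor \<open>q\<close> is given away to match the summands of
    \<open>B (Suc i)\<close>.\<close>
  have PW_Suc: "cmod (P i * (W (Suc i + d) * g (Suc i + d))) \<le> C * (q ^ d * cmod (g (Suc i + d)))" for i d
  proof -
    have "cmod (P i * (W (Suc i + d) * g (Suc i + d))) \<le> C * (q ^ Suc d * cmod (g (Suc i + d)))"
      using PW[of i "Suc d"] by simp
    also have "\<dots> \<le> C * (q ^ d * cmod (g (Suc i + d)))"
      using q C by (intro mult_left_mono mult_right_mono power_decreasing) auto
    finally show ?thesis .
  qed
  \<comment> \<open>As \<open>P 0 = 1\<close>, the decay hypothesis with first index 0 bounds
    \<open>W\<close> itself.\<close>
  have sW: "summable (\<lambda>d. W (m + d) * g (m + d))" for m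
  proof (rule summable_comparison_test'[of "\<lambda>d. C * (q ^ d * cmod (g (m + d)))" 0])
    show "summable (\<lambda>d. C * (q ^ d * cmod (g (m + d))))" by (intro summable_mult sB)
    fix d
    have "cmod (W (m + d) * g (m + d)) \<le> C * (q ^ (m + d) * cmod (g (m + d)))"
      using PW[of 0 "m + d"] by simp
    also have "\<dots> \<le> C * (q ^ d * cmod (g (m + d)))"
      using q C by (intro mult_left_mono mult_right_mono power_decreasing) auto
    finally show "norm (W (m + d) * g (m + d)) \<le> C * (q ^ d * cmod (g (m + d)))" .
  qed
  have T: "T i = W (Suc i) * g (Suc i) + T (Suc i)" for i
    unfolding T_def using suminf_split_head[OF sW[of "Suc i"]] by simp
  have S: "S (Suc i) = S i + P (Suc i) * g (Suc i)" for i
    by (simp add: S_def)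
  have Ju: "J u j = g j" for j
  proof (cases j)
    case 0
    have "J u 0 = S 0 * J W 0 + T 0 * J P 0"
      unfolding J_0 u_def T[of 0] One_nat_def S[of 0] by (simp only: algebra_simps)
    then show ?thesis unfolding W J_P using 0 by (simp add: S_def)
  next
    case (Suc i)
    \<comment> \<open>Rewriting both neighbours with \<open>S (Suc i)\<close> and
      \<open>T (Suc i)\<close> cancels the correction on the right and leaves a Wronskian on the
      left.\<close>
    have "J u (Suc i) = S (Suc i) * J W (Suc i) + T (Suc i) * J P (Suc i)
        + g (Suc i) * (a i * (P i * W (Suc i) - P (Suc i) * W i))"
      unfolding J_Suc u_def T[of i] T[of "Suc i"] S[of i] S[of "Suc i"] by (simp only: algebra_simps)
    then show ?thesis unfolding W J_P wronskian[OF W] using Suc by simp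
  qed
  have "l2_bound A (K / (1 - q))"
  proof (rule l2_bound_geometric_past[OF g])
    fix i
    have "(\<Sum>j\<le>i. q ^ (Suc i - j) * cmod (g j)) = q * A i"
      unfolding A_def sum_distrib_left by (intro sum.cong) (auto simp: Suc_diff_le)
    then show "A (Suc i) = q * A i + cmod (g (Suc i))" by (simp add: A_def)
  qed (use q in \<open>auto simp: A_def\<close>)
  moreover have "l2_bound (\<lambda>i. B (Suc i)) (K / (1 - q)\<^sup>2)"
    unfolding B_def using q by (intro l2_bound_Suc l2_bound_geometric_future[OF g]) auto
  ultimately have "l2_bound (\<lambda>i. C * A i + C * B (Suc i)) (C * (K / (1 - q)) + C * (K / (1 - q)\<^sup>2))"
    using C by (intro l2_bound_add l2_bound_mult) auto
  moreover have "cmod (u i) \<le> C * A i + C * B (Suc i)" for i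
  proof -
    have "cmod (W i * S i) \<le> C * A i"
      unfolding S_def A_def sum_distrib_left
    proof (rule sum_norm_le)
      fix j assume "j \<in> {..i}"
      then show "cmod (W i * (P j * g j)) \<le> C * (q ^ (i - j) * cmod (g j))"
        using mult_right_mono[OF dec[of j i] norm_ge_zero[of "g j"]] by (simp add: norm_mult mult_ac)
    qed
    moreover have "cmod (P i * T i) \<le> C * B (Suc i)"
      unfolding T_def B_def suminf_mult[OF sW, symmetric] suminf_mult[OF sB, symmetric]
      by (intro norm_suminf_le PW_Suc summable_mult sB)
    ultimately show ?thesis
      unfolding u_def by (intro order_trans[OF norm_triangle_ineq] add_mono)
  qed
  ultimately have "l2_bound (\<lambda>j. cmod (u j)) (C * (K / (1 - q)) + C * (K / (1 - q)\<^sup>2))"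
    by (rule l2_bound_mono[OF _ norm_ge_zero])
  then show thesis
    by (intro that[of u] Ju) (simp add: distrib_right)
qed

lemma last_entry_add: "last_entry (\<lambda>r. v r + w r) j = last_entry v j + last_entry w j"
  by (simp add: last_entry_def)

lemma last_entry_mult: "last_entry (\<lambda>r. c * w r) j = c * last_entry w j"
  by (simp add: last_entry_def)

lemma H_add: "H (\<lambda>r. v r + w r) r = H v r + H w r"
proof -
  obtain j s where r: "r = n j + s" and s: "s < degree (p j)" by (rule block_cases)
  show ?thesis unfolding r H_apply[OF s] last_entry_add by (simp add: algebra_simps)
qed

lemma H_mult: "H (\<lambda>r. c * w r) r = c * H w r"
proof -
  obtain j s where r: "r = n j + s" and s: "s < degree (p j)" by (rule block_cases)
  show ?thesis unfolding r H_apply[OF s] last_entry_mult by (simp add: algebra_simps)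
qed

text \<open>Solutions exist by \<open>green_solve\<close> and back substitution, and are unique by
  \<open>J_injective\<close>. The solution map is therefore well defined, linear and
  bounded.\<close>

lemma resolvent_of_weyl_solution:
  assumes weyl: "weyl_solution \<epsilon> p b z W"
    and dec: "\<And>i j. i \<le> j \<Longrightarrow> cmod (P i * W j) \<le> C * q ^ (j - i)"
    and q: "0 < q" "q < 1" and C: "0 < C"
  shows "z \<in> resolvent_set H"
proof -
  obtain m where Wm: "W = (\<lambda>j. Q j + m * P j)" and W: "W \<in> l2"
    using weyl unfolding weyl_solution_def by blast
  have JW: "J W j = (if j = 0 then 1 else 0)" for j
    unfolding Wm by (rule J_Weyl)
  define \<Gamma> where "\<Gamma> = C / (1 - q) + C / (1 - q)\<^sup>2"
  \<comment> \<open>\<open>\<Gamma> * (zbound * sqrt N)\<close> bounds \<open>u\<close> through the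
    moments of \<open>f\<close>, the inner \<open>sqrt N\<close> bounds its block sums, and the
    outer one is the cost of reassembling the blocks.\<close>
  define \<Lambda> where "\<Lambda> = sqrt N * (solution_const * (\<Gamma> * (zbound * sqrt N) + sqrt N))"
  define sol where "sol f w \<longleftrightarrow> w \<in> l2 \<and> (\<lambda>r. H w r - z * w r) = f" for f w
  have ex: "\<exists>w. sol f w \<and> l2_norm w \<le> \<Lambda> * l2_norm f" if f: "f \<in> l2" for f
  proof -
    let ?K = "l2_norm f"
    have bs: "l2_bound (block_sum f) (sqrt N * ?K)"
      by (rule l2_bound_block_sum[OF l2_bound_l2_norm[OF f]])
    have "l2_bound (\<lambda>j. cmod (moment f j)) (zbound * (sqrt N * ?K))"
      by (rule l2_bound_mono[OF l2_bound_mult[OF bs]]) (use zbound_ge_1 cmod_moment_le in auto)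
    from green_solve[OF JW dec q C this] obtain u where u: "\<And>j. J u j = moment f j"
      "l2_bound (\<lambda>j. cmod (u j)) (\<Gamma> * (zbound * (sqrt N * ?K)))"
      unfolding \<Gamma>_def by blast
    have w: "l2_bound (\<lambda>r. cmod (solution u f r)) (\<Lambda> * ?K)"
      using l2_bound_solution[OF u(2) bs] by (simp add: \<Lambda>_def algebra_simps)
    show ?thesis
      unfolding sol_def
      using l2_bound_in_l2[OF w] l2_bound_l2_norm_le[OF w] solution_solves[OF u(1)] by blast
  qed
  have unique: "w = w'" if "sol f w" "sol f w'" for f w w'
  proof -
    have w: "w \<in> l2" "w' \<in> l2" using that by (auto simp: sol_def)
    have eqs: "(\<lambda>r. H w r - z * w r) = f" "(\<lambda>r. H w' r - z * w' r) = f"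
      using that by (auto simp: sol_def)
    define v where "v r = w r + (-1) * w' r" for r
    have "l2_bound (\<lambda>r. cmod (w r) + cmod (w' r)) (l2_norm w + l2_norm w')"
      by (intro l2_bound_add l2_bound_l2_norm w)
    then have v: "l2_bound (\<lambda>r. cmod (v r)) (l2_norm w + l2_norm w')"
      by (rule l2_bound_mono) (auto simp: v_def norm_triangle_ineq4)
    have "(\<lambda>r. H v r - z * v r) = (\<lambda>r. (H w r - z * w r) - (H w' r - z * w' r))"
      unfolding v_def H_add H_mult by (simp add: algebra_simps)
    then have Hv: "(\<lambda>r. H v r - z * v r) = (\<lambda>_. 0)"
      using fun_cong[OF eqs(1)] fun_cong[OF eqs(2)] by simp
    then have "J (reduced v) j = 0" for j
      unfolding resolvent_equation_iff by (simp add: moment_def)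
    with JW W l2_bound_in_l2[OF l2_bound_reduced[OF v]] have "reduced v = (\<lambda>_. 0)"
      by (rule J_injective)
    \<comment> \<open>Back substitution from zero last entries and zero right-hand side gives
      zero.\<close>
    then have "v (n j + s) = 0" if "s < degree (p j)" for j s
      using Hv that unfolding resolvent_equation_iff by (simp add: block_solution_def block_rhs_def)
    then have "v = (\<lambda>_. 0)" by (simp add: fun_eq_blocks)
    then show ?thesis by (simp add: v_def fun_eq_iff)
  qed
  define R where "R f = (THE w. sol f w)" for f
  have R_eq: "R f = w" if "sol f w" for f w
    unfolding R_def using that unique by blast
  have R: "sol f (R f)" "l2_norm (R f) \<le> \<Lambda> * l2_norm f" if "f \<in> l2" for f
    using ex[OF that] R_eq by auto
  have l2_add: "(\<lambda>r. v r + w r) \<in> l2" if "v \<in> l2" "w \<in> l2" for v w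
    by (rule l2_bound_in_l2[OF l2_bound_mono[OF l2_bound_add[OF l2_bound_l2_norm[OF that(1)]
      l2_bound_l2_norm[OF that(2)]]]]) (auto simp: norm_triangle_ineq)
  have l2_mult: "(\<lambda>r. c * w r) \<in> l2" if "w \<in> l2" for c w
    by (rule l2_comparison[OF that, of 0 _ "cmod c"]) (simp add: norm_mult)
  have "l2_bounded_operator R"
    unfolding l2_bounded_operator_def
  proof (intro conjI ballI allI)
    show "R v \<in> l2" if "v \<in> l2" for v using R[OF that] by (simp add: sol_def)
    \<comment> \<open>Linearity comes from uniqueness: the sum of the solutions solves the summed
      equation.\<close>
    show "R (\<lambda>r. v r + w r) = (\<lambda>r. R v r + R w r)" if "v \<in> l2" "w \<in> l2" for v w
    proof (rule R_eq)
      have "(\<lambda>r. H (\<lambda>r. R v r + R w r) r - z * (R v r + R w r)) =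
          (\<lambda>r. (H (R v) r - z * R v r) + (H (R w) r - z * R w r))"
        unfolding H_add by (simp add: algebra_simps)
      then show "sol (\<lambda>r. v r + w r) (\<lambda>r. R v r + R w r)"
        using R(1)[OF that(1)] R(1)[OF that(2)] by (simp add: sol_def l2_add fun_eq_iff)
    qed
    show "R (\<lambda>r. c * w r) = (\<lambda>r. c * R w r)" if "w \<in> l2" for c w
    proof (rule R_eq)
      have "(\<lambda>r. H (\<lambda>r. c * R w r) r - z * (c * R w r)) = (\<lambda>r. c * (H (R w) r - z * R w r))"
        unfolding H_mult by (simp add: algebra_simps)
      then show "sol (\<lambda>r. c * w r) (\<lambda>r. c * R w r)"
        using R(1)[OF that] by (simp add: sol_def l2_mult fun_eq_iff)
    qed
    show "\<exists>K. \<forall>v\<in>l2. l2_norm (R v) \<le> K * l2_norm v" using R(2) by blast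
  qed
  moreover have "R (\<lambda>r. H w r - z * w r) = w" if "w \<in> l2" for w
    by (rule R_eq) (simp add: sol_def that)
  moreover have "(\<lambda>r. H (R w) r - z * R w r) = w" if "w \<in> l2" for w
    using R(1)[OF that] by (simp add: sol_def)
  ultimately show ?thesis
    unfolding resolvent_set_def by blast
qed

end

theorem theorem5p3:
  fixes \<epsilon> :: "nat \<Rightarrow> real" and p :: "nat \<Rightarrow> real poly" and b :: "nat \<Rightarrow> real" and z :: complex
  assumes "\<And>j. lead_coeff (p j) = 1"
    and "\<And>j. degree (p j) \<ge> 1"
    and "\<And>j. \<epsilon> j \<in> {1, -1}"
    and "\<And>j. b j > 0"
    and "\<exists>N::nat. \<forall>j. degree (p j) \<le> N"
    and "bdd_above ({b j | j. True} \<union> {\<bar>coeff (p j) k\<bar> | j k. k < degree (p j)})"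
  shows "z \<in> resolvent_set (matrix_operator (gen_jacobi_matrix \<epsilon> p b)) \<longleftrightarrow>
    (\<exists>W. weyl_solution \<epsilon> p b z W \<and>
      (\<exists>q C :: real. 0 < q \<and> q < 1 \<and> 0 < C \<and>
        (\<forall>i j. i \<le> j \<longrightarrow>
          cmod (jacobi_P \<epsilon> p b i z * W j) \<le> C * q ^ (block_start p j - block_start p i))))"
proof -
  obtain N where N: "\<And>j. degree (p j) \<le> N" using assms(5) by blast
  obtain M where M: "\<And>x. x \<in> {b j | j. True} \<union> {\<bar>coeff (p j) k\<bar> | j k. k < degree (p j)} \<Longrightarrow> x \<le> M"
    using assms(6) unfolding bdd_above_def by blast
  have "b j \<le> M" for j by (rule M) blast
  moreover have "\<bar>coeff (p j) k\<bar> \<le> M" if "k < degree (p j)" for j k by (rule M) (use that in blast)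
  ultimately interpret gen_jacobi \<epsilon> p b z N M
    using assms(1-4) N by unfold_locales
  show ?thesis
  proof
    assume "z \<in> resolvent_set H"
    then show "\<exists>W. weyl_solution \<epsilon> p b z W \<and> (\<exists>q C. 0 < q \<and> q < 1 \<and> 0 < C \<and>
        (\<forall>i j. i \<le> j \<longrightarrow> cmod (P i * W j) \<le> C * q ^ (n j - n i)))"
      by (rule weyl_solution_of_resolvent) blast
  next
    assume "\<exists>W. weyl_solution \<epsilon> p b z W \<and> (\<exists>q C. 0 < q \<and> q < 1 \<and> 0 < C \<and>
        (\<forall>i j. i \<le> j \<longrightarrow> cmod (P i * W j) \<le> C * q ^ (n j - n i)))"
    then obtain W q C where W: "weyl_solution \<epsilon> p b z W" and q: "0 < q" "q < 1" and C: "0 < C"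
      and dec: "\<And>i j. i \<le> j \<Longrightarrow> cmod (P i * W j) \<le> C * q ^ (n j - n i)"
      by blast
    \<comment> \<open>Decay in row indices implies decay in block indices at the same rate, since
      \<open>j - i \<le> n j - n i\<close>.\<close>
    have "cmod (P i * W j) \<le> C * q ^ (j - i)" if "i \<le> j" for i j
    proof -
      have "C * q ^ (n j - n i) \<le> C * q ^ (j - i)"
        using q C n_diff_ge[OF that] by (intro mult_left_mono power_decreasing) auto
      then show ?thesis using dec[OF that] by linarith
    qed
    with W show "z \<in> resolvent_set H"
      by (rule resolvent_of_weyl_solution[OF _ _ q C])
  qed
qed

end
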